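(* Let $X$ be a real Banach lattice, let $E\subset X$ be a closed subspace, let $(e_n)_{n\in\mathbb{N}}$ be a semi-normalized uniformly quasi-greedy basis of $E$, and let $a>1$. The following are equivalent: (i) For all real sequences $(\lambda_n)$ with $1\leq|\lambda_n|\leq a$ for all $n$, the basis $(\lambda_n e_n)$ is uniformly quasi-greedy. (ii) For all $x\in E$ and any permutation $\pi:\mathbb{N}\to\mathbb{N}$ such that $\pi(A_k^a(x))=A_k^a(x)$ for all $k\in\mathbb{Z}$, there exists $u\in X$ such that $$\forall k\in\mathbb{Z}:\quad \bigvee_{n=1}^{t_k}\left|\sum_{i=1}^{n} e^*_{\pi(s_i^k)}(x)\,e_{\pi(s_i^k)}\right|\leq u.$$ (iii) For all $x\in E$ and any permutation $\pi:\mathbb{N}\to\mathbb{N}$ such that $\pi(A_k^a(x))=A_k^a(x)$ for all $k\in\mathbb{Z}$, there exists $C>0$ such that $$\forall N\in\mathbb{N}:\quad \left\|\bigvee_{k=-N}^{N}\bigvee_{n=1}^{t_k}\left|\sum_{i=1}^{n} e^*_{\pi(s_i^k)}(x)\,e_{\pi(s_i^k)}\right|\right\|\leq C.$$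
   Context: All Banach spaces are over $\mathbb{R}$; $E$ carries the norm of $X$. "Basis" means Schauder basis; semi-normalized means $0<\inf_n\|e_n\|\le\sup_n\|e_n\|<\infty$; $e_n^*$ denotes the biorthogonal (coefficient) functionals and $\mathrm{supp}(x)=\{n: e_n^*(x)\ne 0\}$. Greedy orderings: a greedy ordering of $x\in E$ is an injective map $\pi:\mathbb{N}\to\mathbb{N}$ with $\mathrm{supp}(x)\subset\pi(\mathbb{N})$ such that $(|e^*_{\pi(n)}(x)|)_n$ is non-increasing. The natural greedy ordering $\sigma$ of $x$ is the greedy ordering such that $j<k$ implies either $|e^*_{\sigma(j)}(x)|>|e^*_{\sigma(k)}(x)|$, or $|e^*_{\sigma(j)}(x)|=|e^*_{\sigma(k)}(x)|$ and $\sigma(j)<\sigma(k)$. The $m$-th natural greedy sum is $\mathcal{G}_m(x)=\sum_{n=1}^m e^*_{\sigma(n)}(x)e_{\sigma(n)}$. A sequence $(x_m)$ in $X$ converges uniformly to $x$ if there is $e\in X$ such that for every $\epsilon>0$ there is $m_0$ with $|x_m-x|\le\epsilon e$ for all $m\ge m_0$. The basis $(e_n)$ of $E\subset X$ is uniformly quasi-greedy if $\mathcal{G}_m(x)$ converges uniformly to $x$ for every $x\in E$. For a scaled basis $(\lambda_n e_n)$ the same definitions are used with its own biorthogonal functionals $\lambda_n^{-1}e_n^*$. For $x\in E$ and $k\in\mathbb{Z}$, $A_k^a(x)=\{n\in\mathbb{N}: a^k<|e_n^*(x)|\leq a^{k+1}\}=\{s_1^k,s_2^k,\dots,s_{t_k}^k\}$,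 a finite set, where $t_k$ is its cardinality and the elements are enumerated in the natural (increasing) order of $\mathbb{N}$. A supremum over an empty index set is read as $0$. *)

theory Defs
  imports "HOL-Analysis.Analysis" "HOL-Library.Lattice_Algebras"
begin

text \<open>A real Banach lattice: the modulus is \<open>\<bar>x\<bar> = sup x (- x)\<close> by the axiom
  \<open>abs_lattice\<close> of the superclass \<open>lattice_ab_group_add_abs\<close>.\<close>

class banach_lattice = banach + ordered_real_vector + lattice_ab_group_add_abs +
  assumes norm_mono_abs: "\<bar>x\<bar> \<le> \<bar>y\<bar> \<Longrightarrow> norm x \<le> norm y"

definition schauder_basis :: "'a::real_normed_vector set \<Rightarrow> (nat \<Rightarrow> 'a) \<Rightarrow> bool" where
  "schauder_basis E e \<longleftrightarrow>
     range e \<subseteq> E \<and> (\<forall>x\<in>E. \<exists>!c :: nat \<Rightarrow> real. (\<lambda>n. c n *\<^sub>R e n) sums x)"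

definition semi_normalized :: "(nat \<Rightarrow> 'a::real_normed_vector) \<Rightarrow> bool" where
  "semi_normalized e \<longleftrightarrow>
     0 < (INF n. norm (e n)) \<and> bdd_above (range (\<lambda>n. norm (e n)))"

text \<open>The biorthogonal functional \<open>e\<^sub>n\<^sup>*\<close>; meaningful only for a Schauder basis \<open>e\<close> of a
  subspace containing \<open>x\<close>. It is computed from \<open>e\<close> itself, so a scaled basis comes
  with its own functionals.\<close>

definition coef :: "(nat \<Rightarrow> 'a::real_normed_vector) \<Rightarrow> nat \<Rightarrow> 'a \<Rightarrow> real" where
  "coef e n x = (THE c :: nat \<Rightarrow> real. (\<lambda>i. c i *\<^sub>R e i) sums x) n"

definition supp :: "(nat \<Rightarrow> 'a::real_normed_vector) \<Rightarrow> 'a \<Rightarrow> nat set" where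
  "supp e x = {n. coef e n x \<noteq> 0}"

definition greedy_ordering ::
  "(nat \<Rightarrow> 'a::real_normed_vector) \<Rightarrow> 'a \<Rightarrow> (nat \<Rightarrow> nat) \<Rightarrow> bool" where
  "greedy_ordering e x \<pi> \<longleftrightarrow>
     inj \<pi> \<and> supp e x \<subseteq> range \<pi> \<and> decseq (\<lambda>n. \<bar>coef e (\<pi> n) x\<bar>)"

definition natural_greedy_ordering ::
  "(nat \<Rightarrow> 'a::real_normed_vector) \<Rightarrow> 'a \<Rightarrow> (nat \<Rightarrow> nat) \<Rightarrow> bool" where
  "natural_greedy_ordering e x \<sigma> \<longleftrightarrow>
     greedy_ordering e x \<sigma> \<and>
     (\<forall>j k. j < k \<longrightarrow>
        \<bar>coef e (\<sigma> j) x\<bar> > \<bar>coef e (\<sigma> k) x\<bar> \<or>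
        \<bar>coef e (\<sigma> j) x\<bar> = \<bar>coef e (\<sigma> k) x\<bar> \<and> \<sigma> j < \<sigma> k)"

text \<open>If \<open>x\<close> has finite support, natural greedy orderings differ in which indices outside the
  support they list, but only zero terms are affected, so the choice below does not matter.
  One exists whenever the coefficients tend to \<open>0\<close>, as they do for a semi-normalized basis.\<close>

definition natural_greedy_sum ::
  "(nat \<Rightarrow> 'a::real_normed_vector) \<Rightarrow> nat \<Rightarrow> 'a \<Rightarrow> 'a" where
  "natural_greedy_sum e m x =
     (let \<sigma> = (SOME \<sigma>. natural_greedy_ordering e x \<sigma>)
      in \<Sum>n<m. coef e (\<sigma> n) x *\<^sub>R e (\<sigma> n))"

definition converges_uniformly :: "(nat \<Rightarrow> 'a::banach_lattice) \<Rightarrow> 'a \<Rightarrow> bool" where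
  "converges_uniformly f x \<longleftrightarrow>
     (\<exists>u. \<forall>\<epsilon>>0. \<exists>m\<^sub>0. \<forall>m\<ge>m\<^sub>0. \<bar>f m - x\<bar> \<le> \<epsilon> *\<^sub>R u)"

definition uniformly_quasi_greedy :: "'a::banach_lattice set \<Rightarrow> (nat \<Rightarrow> 'a) \<Rightarrow> bool" where
  "uniformly_quasi_greedy E e \<longleftrightarrow>
     (\<forall>x\<in>E. converges_uniformly (\<lambda>m. natural_greedy_sum e m x) x)"

definition level_set ::
  "real \<Rightarrow> (nat \<Rightarrow> 'a::real_normed_vector) \<Rightarrow> 'a \<Rightarrow> int \<Rightarrow> nat set" where
  "level_set a e x k = {n. a powi k < \<bar>coef e n x\<bar> \<and> \<bar>coef e n x\<bar> \<le> a powi (k + 1)}"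

text \<open>Finite lattice supremum, with the convention that the empty supremum is \<open>0\<close>.\<close>

definition fin_sup :: "('i \<Rightarrow> 'a::banach_lattice) \<Rightarrow> 'i set \<Rightarrow> 'a" where
  "fin_sup f I = (if I = {} then 0 else Sup_fin (f ` I))"

text \<open>\<open>enumerate (level_set a e x k) i\<close> is \<open>s\<^sub>i\<^sub>+\<^sub>1\<^sup>k\<close>, the increasing enumeration starting at
  index \<open>0\<close>; only indices below the cardinality are used.\<close>

definition level_sup ::
  "real \<Rightarrow> (nat \<Rightarrow> 'a::banach_lattice) \<Rightarrow> 'a \<Rightarrow> (nat \<Rightarrow> nat) \<Rightarrow> int \<Rightarrow> 'a" where
  "level_sup a e x \<pi> k =
     (let s = enumerate (level_set a e x k)
      in fin_sup (\<lambda>n. \<bar>\<Sum>i<n. coef e (\<pi> (s i)) x *\<^sub>R e (\<pi> (s i))\<bar>)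
           {1..card (level_set a e x k)})"

end

theory Submission
  imports Defs
begin

text \<open>
  Scaling by \<open>1 \<le> \<bar>l n\<bar> \<le> a\<close> can reorder the coefficients inside a level set \<open>A\<^sub>k\<close>
  arbitrarily without mixing levels, so under (i) the partial sums over \<open>A\<^sub>k\<close> along any
  permutation are differences of two greedy sums of one scaled basis, and these are order
  bounded; this is (ii). Conversely a greedy sum of a scaled basis is a greedy sum of the original
  basis plus partial sums over two adjacent level sets, taken along the permutation that sorts each
  level by the scaled coefficients. Hence (iii) bounds in norm the finite suprema of greedy sums of
  the scaled basis, for each \<open>x\<close>. A gliding hump argument turns this into smallness of the
  greedy sums of the tails of \<open>x\<close>, and adding up dominating elements of finite blocks of greedy
  sums gives the regulator of uniform convergence.
\<close>

subsection \<open>Order and norm in a Banach lattice\<close>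

text \<open>Norm bounds on an increasing family of finite suprema give no upper bound in a general
  Banach lattice, so (iii) does not lead back to (ii) directly; hence the cycle (i), (ii), (iii),
  (i). In the last implication the regulator has to be built as the sum of an absolutely convergent
  series of positive elements, which dominates each of its terms. Such a series needs norm bounds
  that decay, whereas (iii) only provides a constant for each vector, of unknown size. The decay
  comes from contradiction: if the tails of one vector did not become small, amplifying them would
  create another vector of \<open>E\<close> for which no constant exists. The same numbers serve
  both constructions. Pieces of norm about \<open>(1/4) ^ j\<close> are multiplied by
  \<open>2 ^ j\<close>: what remains, \<open>(1/2) ^ j\<close>, is still summable, while the factor
  makes the humps unbounded in one case and the error small relative to the regulator in the
  other.\<close>

lemma norm_abs_eq: "norm \<bar>x\<bar> = norm (x :: 'a::banach_lattice)"
  by (intro antisym norm_mono_abs) simp_all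

lemma norm_mono_nonneg: "norm x \<le> norm (y :: 'a::banach_lattice)" if "\<bar>x\<bar> \<le> y"
proof -
  have "\<bar>x\<bar> \<le> \<bar>y\<bar>" using that abs_ge_self order_trans by blast
  then show ?thesis by (rule norm_mono_abs)
qed

text \<open>Monotonicity of scaling gives one inequality for each positive scalar; the reverse one
  is the same inequality for the inverse scalar.\<close>

lemma abs_scaleR_nonneg: "\<bar>r *\<^sub>R x\<bar> = r *\<^sub>R \<bar>x :: 'a::banach_lattice\<bar>" if "0 \<le> r"
proof (cases "r = 0")
  case False
  then have r: "0 < r" using that by simp
  have ub: "\<bar>s *\<^sub>R y\<bar> \<le> s *\<^sub>R \<bar>y\<bar>" if "0 < s" for s and y :: 'a
  proof (rule abs_leI)
    show "s *\<^sub>R y \<le> s *\<^sub>R \<bar>y\<bar>" using that by (intro scaleR_left_mono) (auto simp: abs_ge_self)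
    have "s *\<^sub>R (- y) \<le> s *\<^sub>R \<bar>y\<bar>" using that by (intro scaleR_left_mono) (auto simp: abs_ge_minus_self)
    then show "- (s *\<^sub>R y) \<le> s *\<^sub>R \<bar>y\<bar>" by simp
  qed
  have "\<bar>inverse r *\<^sub>R (r *\<^sub>R x)\<bar> \<le> inverse r *\<^sub>R \<bar>r *\<^sub>R x\<bar>"
    using r by (intro ub) simp
  then have "r *\<^sub>R \<bar>x\<bar> \<le> r *\<^sub>R (inverse r *\<^sub>R \<bar>r *\<^sub>R x\<bar>)"
    using r by (intro scaleR_left_mono) auto
  then show ?thesis using ub[OF r, of x] r by (intro antisym) auto
qed simp

text \<open>The negative part of the limit lies below \<open>\<bar>f n - l\<bar>\<close> as soon as
  \<open>f n\<close> is positive, so the lattice norm forces it to vanish.\<close>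

lemma nonneg_limit:
  fixes f :: "nat \<Rightarrow> 'a::banach_lattice"
  assumes lim: "f \<longlonglongrightarrow> l" and nn: "\<forall>\<^sub>F n in sequentially. 0 \<le> f n"
  shows "0 \<le> l"
proof -
  have "norm (sup (- l) 0) \<le> norm (f n - l)" if "0 \<le> f n" for n
  proof -
    have "- l \<le> f n - l" using that by simp
    also have "\<dots> \<le> \<bar>f n - l\<bar>" by (rule abs_ge_self)
    finally have "sup (- l) 0 \<le> \<bar>f n - l\<bar>" by simp
    then have "\<bar>sup (- l) 0\<bar> \<le> \<bar>f n - l\<bar>" by (simp add: abs_of_nonneg)
    then show ?thesis by (rule norm_mono_abs)
  qed
  then have ev: "\<forall>\<^sub>F n in sequentially. norm (sup (- l) 0) \<le> norm (f n - l)"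
    using nn by (auto elim: eventually_mono)
  have "(\<lambda>n. norm (f n - l)) \<longlonglongrightarrow> 0"
    using lim LIM_zero tendsto_norm_zero by blast
  then have "norm (sup (- l) 0) \<le> 0"
    using ev by (intro tendsto_lowerbound[of _ 0 sequentially]) auto
  then have "sup (- l) 0 = 0" by simp
  then have "- l \<le> 0" by (metis sup_ge1)
  then show ?thesis by simp
qed

text \<open>This is how a common upper bound for infinitely many elements is obtained without order
  completeness: partial sums dominate the term, and the positive cone is closed.\<close>

lemma term_le_suminf:
  fixes z :: "nat \<Rightarrow> 'a::banach_lattice"
  assumes "summable z" and nn: "\<And>j. 0 \<le> z j"
  shows "z i \<le> (\<Sum>j. z j)"
proof -
  have "(\<lambda>n. (\<Sum>j<n. z j) - z i) \<longlonglongrightarrow> (\<Sum>j. z j) - z i"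
    using assms(1) by (intro tendsto_intros summable_LIMSEQ)
  moreover have "\<forall>\<^sub>F n in sequentially. 0 \<le> (\<Sum>j<n. z j) - z i"
    using eventually_gt_at_top[of i]
  proof eventually_elim
    case (elim n)
    have "(\<Sum>j<n. z j) = z i + (\<Sum>j\<in>{..<n} - {i}. z j)"
      using elim by (simp add: sum.remove)
    then show ?case by (simp add: sum_nonneg nn)
  qed
  ultimately show ?thesis using nonneg_limit by fastforce
qed

lemma fin_sup_upper: "finite I \<Longrightarrow> i \<in> I \<Longrightarrow> f i \<le> fin_sup f I"
  by (auto simp: fin_sup_def intro: Sup_fin.coboundedI)

lemma fin_sup_least:
  "finite I \<Longrightarrow> (\<And>i. i \<in> I \<Longrightarrow> f i \<le> u) \<Longrightarrow> 0 \<le> u \<Longrightarrow> fin_sup f I \<le> u"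
  by (auto simp: fin_sup_def intro: Sup_fin.boundedI)

lemma fin_sup_nonneg: "finite I \<Longrightarrow> (\<And>i. i \<in> I \<Longrightarrow> 0 \<le> f i) \<Longrightarrow> 0 \<le> fin_sup f I"
  by (metis all_not_in_conv fin_sup_def fin_sup_upper order_refl order_trans)

subsection \<open>Greedy sets\<close>

definition precedes :: "(nat \<Rightarrow> real) \<Rightarrow> nat \<Rightarrow> nat \<Rightarrow> bool" where
  "precedes h i j \<longleftrightarrow> h j < h i \<or> h i = h j \<and> i < j"

text \<open>A greedy set is an initial segment of the natural greedy ordering that consists of indices
  with nonzero coefficient, so the greedy sums are exactly the sums over greedy sets; this
  removes the choice of an ordering.\<close>

definition greedy_set :: "(nat \<Rightarrow> real) \<Rightarrow> nat set \<Rightarrow> bool" where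
  "greedy_set h B \<longleftrightarrow> finite B \<and> (\<forall>i\<in>B. 0 < h i \<and> (\<forall>j. j \<notin> B \<longrightarrow> precedes h i j))"

definition top_set :: "(nat \<Rightarrow> real) \<Rightarrow> nat \<Rightarrow> nat set" where
  \<comment> \<open>An index with \<open>h n = 0\<close> may have infinitely many predecessors, in
    which case \<open>card\<close> is 0; the condition \<open>0 < h n\<close> keeps such indices
    out.\<close>
  "top_set h m = {n. 0 < h n \<and> card {j. precedes h j n} < m}"

lemma precedes_irrefl: "\<not> precedes h i i"
  and precedes_trans: "precedes h i j \<Longrightarrow> precedes h j k \<Longrightarrow> precedes h i k"
  and precedes_total: "i \<noteq> j \<Longrightarrow> precedes h i j \<or> precedes h j i"
  by (auto simp: precedes_def)

lemma finite_precedes: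
  assumes "h \<longlonglongrightarrow> 0" "0 < h n"
  shows "finite {j. precedes h j n}"
proof -
  from assms have "\<forall>\<^sub>F j in sequentially. h j < h n" by (auto intro: order_tendstoD)
  then obtain N where "\<And>j. N \<le> j \<Longrightarrow> h j < h n" by (auto simp: eventually_sequentially)
  then have "{j. precedes h j n} \<subseteq> {..<N}"
    unfolding precedes_def by (smt (verit) lessThan_iff mem_Collect_eq not_le_imp_less subsetI)
  then show ?thesis by (rule finite_subset) simp
qed

lemma rank_less:
  assumes "precedes h i j" "i \<in> D" "finite {m\<in>D. precedes h m j}"
  shows "card {m\<in>D. precedes h m i} < card {m\<in>D. precedes h m j}"
proof (rule psubset_card_mono[OF assms(3)])
  show "{m\<in>D. precedes h m i} \<subset> {m\<in>D. precedes h m j}"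
    using assms(1,2) precedes_irrefl[of h i] precedes_trans[of h _ i j] by blast
qed

lemma rank_bij_finite:
  assumes "finite D"
  shows "bij_betw (\<lambda>n. card {m\<in>D. precedes h m n}) D {..<card D}"
proof -
  let ?r = "\<lambda>n. card {m\<in>D. precedes h m n}"
  have less: "?r i < ?r j" if "precedes h i j" "i \<in> D" for i j
    using that assms by (intro rank_less) auto
  have "inj_on ?r D"
  proof (rule inj_onI, rule ccontr)
    fix i j assume "i \<in> D" "j \<in> D" "?r i = ?r j" "i \<noteq> j"
    then show False using less[of i j] less[of j i] precedes_total[of i j h] by auto
  qed
  moreover have "?r n < card D" if "n \<in> D" for n
    using that assms precedes_irrefl[of h n] by (intro psubset_card_mono) auto
  then have "?r ` D \<subseteq> {..<card D}" by auto
  ultimately show ?thesis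
    by (simp add: bij_betw_def card_image card_subset_eq)
qed

text \<open>The finite case, applied to the predecessors of \<open>n\<close>, shows that every
  number below the rank of \<open>n\<close> is a rank. A downward closed infinite set of naturals is
  everything.\<close>

lemma rank_bij_infinite:
  assumes inf: "infinite D" and fin: "\<And>n. n \<in> D \<Longrightarrow> finite {m\<in>D. precedes h m n}"
  shows "bij_betw (\<lambda>n. card {m\<in>D. precedes h m n}) D UNIV"
proof -
  let ?r = "\<lambda>n. card {m\<in>D. precedes h m n}"
  have less: "?r i < ?r j" if "precedes h i j" "i \<in> D" "j \<in> D" for i j
    using that fin by (intro rank_less) auto
  have inj: "inj_on ?r D"
  proof (rule inj_onI, rule ccontr)
    fix i j assume "i \<in> D" "j \<in> D" "?r i = ?r j" "i \<noteq> j"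
    then show False using less[of i j] less[of j i] precedes_total[of i j h] by auto
  qed
  have down: "{..<?r n} \<subseteq> ?r ` D" if n: "n \<in> D" for n
  proof -
    let ?P = "{m\<in>D. precedes h m n}"
    have "(\<lambda>k. card {m\<in>?P. precedes h m k}) ` ?P = {..<card ?P}"
      using rank_bij_finite[OF fin[OF n], of h] by (simp add: bij_betw_def)
    \<comment> \<open>Transitivity: predecessors of \<open>k\<close> are predecessors of
      \<open>n\<close>, so ranks inside \<open>?P\<close> agree with ranks inside
      \<open>D\<close>.\<close>
    moreover have "{m\<in>?P. precedes h m k} = {m\<in>D. precedes h m k}" if "k \<in> ?P" for k
      using that precedes_trans[of h _ k n] by auto
    ultimately have "?r ` ?P = {..<?r n}" by (metis (no_types, lifting) image_cong)
    then show ?thesis by blast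
  qed
  have "x \<in> ?r ` D" for x
  proof -
    have "infinite (?r ` D)" using inf inj by (simp add: finite_image_iff)
    then obtain y where "y \<in> ?r ` D" "x < y" by (meson infinite_nat_iff_unbounded)
    then show ?thesis using down by blast
  qed
  then show ?thesis using inj by (auto simp: bij_betw_def)
qed

lemma greedy_set_top_set:
  assumes "h \<longlonglongrightarrow> 0"
  shows "greedy_set h (top_set h m)"
proof -
  let ?r = "\<lambda>n. card {j. precedes h j n}"
  have less: "?r i < ?r j" if "precedes h i j" "0 < h j" for i j
    using rank_less[of h i j UNIV] that finite_precedes[OF assms] by simp
  have "inj_on ?r (top_set h m)"
    by (rule inj_onI) (metis (mono_tags, lifting) less mem_Collect_eq nat_neq_iff precedes_total top_set_def)
  moreover have "?r ` top_set h m \<subseteq> {..<m}" by (auto simp: top_set_def)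
  ultimately have "finite (top_set h m)" using finite_subset inj_on_finite by blast
  moreover have "precedes h i j" if "i \<in> top_set h m" "j \<notin> top_set h m" for i j
  proof (rule ccontr)
    assume "\<not> precedes h i j"
    then have ji: "precedes h j i" using that precedes_total by metis
    then have "0 < h j" using that(1) by (auto simp: top_set_def precedes_def)
    then show False using less[OF ji] that by (auto simp: top_set_def)
  qed
  moreover have "0 < h i" if "i \<in> top_set h m" for i using that by (simp add: top_set_def)
  ultimately show ?thesis unfolding greedy_set_def by blast
qed

text \<open>All predecessors of a member of \<open>B\<close> lie in \<open>B\<close> and differ from
  it, so there are fewer than \<open>card B\<close>; an index outside \<open>B\<close> is preceded
  by all of \<open>B\<close>.\<close>

lemma top_set_card:
  assumes "h \<longlonglongrightarrow> 0" and B: "greedy_set h B"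
  shows "top_set h (card B) = B"
proof (intro equalityI subsetI)
  have fin: "finite B" using B by (simp add: greedy_set_def)
  fix n assume n: "n \<in> B"
  then have "{j. precedes h j n} \<subset> B"
    using B unfolding greedy_set_def by (metis (mono_tags) mem_Collect_eq precedes_irrefl precedes_trans psubsetI subsetI)
  then show "n \<in> top_set h (card B)"
    using n B fin by (auto simp: top_set_def greedy_set_def psubset_card_mono)
next
  fix n assume n: "n \<in> top_set h (card B)"
  show "n \<in> B"
  proof (rule ccontr)
    assume "n \<notin> B"
    then have "B \<subseteq> {j. precedes h j n}" using B by (auto simp: greedy_set_def)
    then have "card B \<le> card {j. precedes h j n}"
      using finite_precedes[OF assms(1)] n by (intro card_mono) (auto simp: top_set_def)
    then show False using n by (auto simp: top_set_def)
  qed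
qed

subsection \<open>Coefficients and natural greedy sums\<close>

lemma coef_eqI:
  assumes "schauder_basis E b" "x \<in> E" "(\<lambda>n. c n *\<^sub>R b n) sums x"
  shows "coef b n x = c n"
proof -
  have "\<exists>!c :: nat \<Rightarrow> real. (\<lambda>n. c n *\<^sub>R b n) sums x"
    using assms by (auto simp: schauder_basis_def)
  then have "(THE c :: nat \<Rightarrow> real. (\<lambda>i. c i *\<^sub>R b i) sums x) = c"
    using assms(3) by (rule the1_equality[where P = "\<lambda>c. (\<lambda>n. c n *\<^sub>R b n) sums x"])
  then show ?thesis by (simp add: coef_def)
qed

lemma coef_sums:
  assumes "schauder_basis E b" "x \<in> E"
  shows "(\<lambda>n. coef b n x *\<^sub>R b n) sums x"
proof -
  obtain c :: "nat \<Rightarrow> real" where c: "(\<lambda>n. c n *\<^sub>R b n) sums x"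
    using assms unfolding schauder_basis_def by blast
  then show ?thesis using coef_eqI[OF assms c] by simp
qed

lemma coef_tendsto_0:
  assumes "schauder_basis E b" "x \<in> E" and c0: "0 < c0" "\<And>n. c0 \<le> norm (b n)"
  shows "(\<lambda>n. \<bar>coef b n x\<bar>) \<longlonglongrightarrow> 0"
proof (rule Lim_null_comparison)
  have "(\<lambda>n. coef b n x *\<^sub>R b n) \<longlonglongrightarrow> 0"
    using coef_sums[OF assms(1,2)] sums_summable summable_LIMSEQ_zero by blast
  then have "(\<lambda>n. norm (coef b n x *\<^sub>R b n) / c0) \<longlonglongrightarrow> 0 / c0"
    using c0 by (intro tendsto_divide tendsto_norm_zero) auto
  then show "(\<lambda>n. norm (coef b n x *\<^sub>R b n) / c0) \<longlonglongrightarrow> 0" by simp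
  show "\<forall>\<^sub>F n in sequentially. norm \<bar>coef b n x\<bar> \<le> norm (coef b n x *\<^sub>R b n) / c0"
    using c0 by (intro always_eventually allI) (simp add: pos_le_divide_eq mult_left_mono)
qed

text \<open>\<open>D\<close> holds the indices that an enumeration in greedy order can reach. It
  contains the support, and if the support is finite it is all of \<open>UNIV\<close>; so it is
  infinite in either case, and the inverse of the rank function lists it in order.\<close>

lemma natural_greedy_ordering_exists:
  assumes lim: "(\<lambda>n. \<bar>coef b n x\<bar>) \<longlonglongrightarrow> 0"
  shows "\<exists>\<sigma>. natural_greedy_ordering b x \<sigma>"
proof -
  define h where "h = (\<lambda>n. \<bar>coef b n x\<bar>)"
  define D where "D = {n. finite {m. precedes h m n}}"
  let ?r = "\<lambda>n. card {m\<in>D. precedes h m n}"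
  have supp: "supp b x \<subseteq> D"
    using finite_precedes[OF lim] by (auto simp: supp_def D_def h_def)
  have "D = UNIV" if fin: "finite (supp b x)"
  proof -
    have "finite {m. precedes h m n}" for n
    proof (rule finite_subset)
      show "{m. precedes h m n} \<subseteq> supp b x \<union> {..n}"
        by (auto simp: precedes_def supp_def h_def)
    qed (use fin in simp)
    then show ?thesis by (simp add: D_def)
  qed
  then have "infinite D" using supp finite_subset by fastforce
  then have bij: "bij_betw ?r D UNIV"
    by (rule rank_bij_infinite) (auto simp: D_def)
  define \<sigma> where "\<sigma> = inv_into D ?r"
  have \<sigma>: "bij_betw \<sigma> UNIV D" unfolding \<sigma>_def by (rule bij_betw_inv_into[OF bij])
  have r\<sigma>: "?r (\<sigma> i) = i" for i
    unfolding \<sigma>_def using bij_betw_inv_into_right[OF bij, of i] by simp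
  have prec: "precedes h (\<sigma> i) (\<sigma> j)" if "i < j" for i j
  proof (rule ccontr)
    assume *: "\<not> precedes h (\<sigma> i) (\<sigma> j)"
    have "\<sigma> i \<noteq> \<sigma> j" using that r\<sigma> by (metis nat_neq_iff)
    then have ji: "precedes h (\<sigma> j) (\<sigma> i)" using * precedes_total by blast
    have "?r (\<sigma> j) \<le> ?r (\<sigma> i)"
    proof (rule card_mono)
      have "\<sigma> i \<in> D" using \<sigma> by (auto simp: bij_betw_def)
      then show "finite {m\<in>D. precedes h m (\<sigma> i)}" by (simp add: D_def)
      show "{m\<in>D. precedes h m (\<sigma> j)} \<subseteq> {m\<in>D. precedes h m (\<sigma> i)}"
        using ji precedes_trans by blast
    qed
    then show False using that r\<sigma> by simp
  qed
  have "natural_greedy_ordering b x \<sigma>"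
    unfolding natural_greedy_ordering_def greedy_ordering_def
  proof (intro conjI allI impI)
    show "inj \<sigma>" "supp b x \<subseteq> range \<sigma>" using \<sigma> supp by (auto simp: bij_betw_def)
    show "decseq (\<lambda>n. \<bar>coef b (\<sigma> n) x\<bar>)"
    proof (rule decseq_SucI)
      show "\<bar>coef b (\<sigma> (Suc n)) x\<bar> \<le> \<bar>coef b (\<sigma> n) x\<bar>" for n
        using prec[of n "Suc n"] by (auto simp: precedes_def h_def)
    qed
    fix j k :: nat assume "j < k"
    then show "\<bar>coef b (\<sigma> k) x\<bar> < \<bar>coef b (\<sigma> j) x\<bar> \<or>
        \<bar>coef b (\<sigma> j) x\<bar> = \<bar>coef b (\<sigma> k) x\<bar> \<and> \<sigma> j < \<sigma> k"
      using prec[of j k] by (auto simp: precedes_def h_def)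
  qed
  then show ?thesis by (rule exI[of _ \<sigma>])
qed

text \<open>Every natural greedy ordering puts an index of nonzero coefficient at the position given
  by its rank, so two choices differ only in terms that vanish.\<close>

lemma natural_greedy_sum_top_set:
  assumes lim: "(\<lambda>n. \<bar>coef b n x\<bar>) \<longlonglongrightarrow> 0"
  shows "natural_greedy_sum b m x = (\<Sum>n\<in>top_set (\<lambda>n. \<bar>coef b n x\<bar>) m. coef b n x *\<^sub>R b n)"
proof -
  define h where "h = (\<lambda>n. \<bar>coef b n x\<bar>)"
  define \<sigma> where "\<sigma> = (SOME \<sigma>. natural_greedy_ordering b x \<sigma>)"
  have "natural_greedy_ordering b x \<sigma>"
    unfolding \<sigma>_def using natural_greedy_ordering_exists[OF lim] by (rule someI_ex)
  then have inj: "inj \<sigma>" and supp: "supp b x \<subseteq> range \<sigma>"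
    and prec: "\<And>i j. i < j \<Longrightarrow> precedes h (\<sigma> i) (\<sigma> j)"
    by (auto simp: natural_greedy_ordering_def greedy_ordering_def precedes_def h_def)
  have range: "n \<in> range \<sigma>" if "0 < h n" for n
    using that supp by (auto simp: h_def supp_def)
  have rank: "card {j. precedes h j (\<sigma> i)} = i" if pos: "0 < h (\<sigma> i)" for i
  proof -
    have "{j. precedes h j (\<sigma> i)} = \<sigma> ` {..<i}"
    proof (intro equalityI subsetI)
      fix j assume j: "j \<in> {j. precedes h j (\<sigma> i)}"
      then have "0 < h j" using pos by (auto simp: precedes_def)
      then obtain k where k: "j = \<sigma> k" using range by blast
      have "k < i"
        using j prec[of i k] precedes_irrefl precedes_trans unfolding k by (metis linorder_neqE_nat mem_Collect_eq)
      then show "j \<in> \<sigma> ` {..<i}" using k by blast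
    qed (use prec in auto)
    then show ?thesis using inj by (simp add: card_image inj_on_subset)
  qed
  have top: "top_set h m = {n \<in> \<sigma> ` {..<m}. 0 < h n}"
    using rank range unfolding top_set_def by fastforce
  have "natural_greedy_sum b m x = (\<Sum>i<m. coef b (\<sigma> i) x *\<^sub>R b (\<sigma> i))"
    by (simp add: natural_greedy_sum_def \<sigma>_def Let_def)
  also have "\<dots> = (\<Sum>n\<in>\<sigma> ` {..<m}. coef b n x *\<^sub>R b n)"
    using inj by (subst sum.reindex) (auto intro: inj_on_subset)
  also have "\<dots> = (\<Sum>n\<in>top_set h m. coef b n x *\<^sub>R b n)"
    unfolding top by (rule sum.mono_neutral_right) (auto simp: h_def)
  finally show ?thesis by (simp add: h_def)
qed

section \<open>Order bounds for greedy sums\<close>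

lemma converges_uniformly_order_bounded:
  fixes f :: "nat \<Rightarrow> 'a::banach_lattice"
  assumes "converges_uniformly f x"
  shows "\<exists>u. \<forall>m. \<bar>f m\<bar> \<le> u"
proof -
  obtain u where u: "\<And>\<epsilon>. 0 < \<epsilon> \<Longrightarrow> \<exists>m0. \<forall>m\<ge>m0. \<bar>f m - x\<bar> \<le> \<epsilon> *\<^sub>R u"
    using assms by (auto simp: converges_uniformly_def)
  obtain m0 where m0: "\<And>m. m0 \<le> m \<Longrightarrow> \<bar>f m - x\<bar> \<le> u" using u[of 1] by auto
  have u0: "0 \<le> u" using m0[of m0] abs_ge_zero order_trans by blast
  have s0: "0 \<le> (\<Sum>m<m0. \<bar>f m\<bar>)" by (simp add: sum_nonneg)
  have "\<bar>f m\<bar> \<le> u + \<bar>x\<bar> + (\<Sum>m<m0. \<bar>f m\<bar>)" for m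
  proof (cases "m < m0")
    case True
    then have "(\<Sum>m<m0. \<bar>f m\<bar>) = \<bar>f m\<bar> + (\<Sum>m\<in>{..<m0} - {m}. \<bar>f m\<bar>)" by (simp add: sum.remove)
    then have "\<bar>f m\<bar> \<le> (\<Sum>m<m0. \<bar>f m\<bar>)" by (simp add: sum_nonneg)
    then show ?thesis using u0 abs_ge_zero[of x] by (simp add: add_increasing)
  next
    case False
    have "\<bar>f m\<bar> \<le> \<bar>f m - x\<bar> + \<bar>x\<bar>" using abs_triangle_ineq[of "f m - x" x] by simp
    also have "\<dots> \<le> u + \<bar>x\<bar>" using m0 False by simp
    finally show ?thesis using s0 by (simp add: add_increasing2)
  qed
  then show ?thesis by blast
qed

lemma uniformly_quasi_greedy_order_bounded:
  fixes b :: "nat \<Rightarrow> 'a::banach_lattice"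
  assumes "uniformly_quasi_greedy E b" "x \<in> E" and lim: "(\<lambda>n. \<bar>coef b n x\<bar>) \<longlonglongrightarrow> 0"
  shows "\<exists>u. \<forall>B. greedy_set (\<lambda>n. \<bar>coef b n x\<bar>) B \<longrightarrow> \<bar>\<Sum>n\<in>B. coef b n x *\<^sub>R b n\<bar> \<le> u"
proof -
  have "converges_uniformly (\<lambda>m. natural_greedy_sum b m x) x"
    using assms by (simp add: uniformly_quasi_greedy_def)
  then obtain u where "\<And>m. \<bar>natural_greedy_sum b m x\<bar> \<le> u"
    using converges_uniformly_order_bounded by blast
  then have "\<bar>\<Sum>n\<in>B. coef b n x *\<^sub>R b n\<bar> \<le> u" if "greedy_set (\<lambda>n. \<bar>coef b n x\<bar>) B" for B
    using top_set_card[OF lim that] natural_greedy_sum_top_set[OF lim, of "card B"] by metis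
  then show ?thesis by blast
qed

section \<open>Rescaling a Schauder basis\<close>

lemma schauder_basis_scaled:
  assumes E: "subspace E" and b: "schauder_basis E b" and l: "\<And>n. l n \<noteq> 0"
  shows "schauder_basis E (\<lambda>n. l n *\<^sub>R b n)"
  unfolding schauder_basis_def
proof (intro conjI ballI)
  show "range (\<lambda>n. l n *\<^sub>R b n) \<subseteq> E"
    using E b by (auto simp: schauder_basis_def subspace_scale)
  fix x assume x: "x \<in> E"
  show "\<exists>!c. (\<lambda>n. c n *\<^sub>R l n *\<^sub>R b n) sums x"
  proof (rule ex1I)
    show "(\<lambda>n. (coef b n x / l n) *\<^sub>R l n *\<^sub>R b n) sums x"
      using coef_sums[OF b x] l by simp
    fix d assume "(\<lambda>n. d n *\<^sub>R l n *\<^sub>R b n) sums x"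
    then have "coef b n x = d n * l n" for n
      using coef_eqI[OF b x, of "\<lambda>n. d n * l n"] by simp
    then show "d = (\<lambda>n. coef b n x / l n)" using l by auto
  qed
qed

lemma coef_scaled:
  assumes E: "subspace E" and b: "schauder_basis E b" and l: "\<And>n. l n \<noteq> 0" and x: "x \<in> E"
  shows "coef (\<lambda>n. l n *\<^sub>R b n) n x = coef b n x / l n"
  using coef_sums[OF b x] l
  by (intro coef_eqI[OF schauder_basis_scaled[OF E b l] x]) simp

subsection \<open>The gliding hump\<close>

text \<open>Finite suprema of the moduli of elements of \<open>S\<close> are bounded in norm by \<open>C\<close>.\<close>

definition fin_dominated :: "real \<Rightarrow> 'a::banach_lattice set \<Rightarrow> bool" where
  "fin_dominated C S \<longleftrightarrow>
     (\<forall>T. finite T \<and> T \<subseteq> S \<longrightarrow> (\<exists>v. norm v \<le> C \<and> (\<forall>t\<in>T. \<bar>t\<bar> \<le> v)))"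

lemma not_fin_dominated_image:
  assumes "\<not> fin_dominated C (f ` S)"
  obtains R where "finite R" "R \<subseteq> S" "\<And>v. (\<And>r. r \<in> R \<Longrightarrow> \<bar>f r\<bar> \<le> v) \<Longrightarrow> C < norm v"
proof -
  obtain T where T: "finite T" "T \<subseteq> f ` S" "\<And>v. (\<forall>t\<in>T. \<bar>t\<bar> \<le> v) \<Longrightarrow> C < norm v"
    using assms unfolding fin_dominated_def by (meson not_le)
  moreover obtain R where "R \<subseteq> S" "finite R" "T = f ` R"
    using finite_subset_image[OF T(1,2)] by blast
  ultimately show ?thesis by (intro that) auto
qed

section \<open>Series amplified on disjoint blocks\<close>

lemma sum_half_powers_le: "(\<Sum>i\<in>{j..<n}. (1/2) ^ i) \<le> 2 * (1/2 :: real) ^ j"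
proof (cases "j \<le> n")
  case True
  then have "(\<Sum>i\<in>{j..<n}. (1/2) ^ i) = 2 * (1/2 :: real) ^ j - 2 * (1/2) ^ n"
    by (induction n rule: nat_induct_at_least) (auto simp: sum.atLeastLessThan_Suc)
  then show ?thesis by simp
qed simp

text \<open>Truncating the sum at \<open>n\<close> loses nothing when \<open>i \<le> N i\<close> for all \<open>i\<close>.\<close>

definition block_weight :: "(nat \<Rightarrow> nat) \<Rightarrow> (nat \<Rightarrow> nat) \<Rightarrow> nat \<Rightarrow> real" where
  "block_weight N M n = (\<Sum>i\<le>n. if n \<in> {N i..<M i} then 2 ^ i else 0)"

text \<open>A truncation common to all indices below \<open>Q\<close> allows the sum over blocks to
  be interchanged with a sum over indices.\<close>

lemma block_weight_eq_sum:
  assumes "\<And>i. i \<le> N i" "n < Q"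
  shows "block_weight N M n = (\<Sum>i<Q. if n \<in> {N i..<M i} then 2 ^ i else 0)"
  unfolding block_weight_def
proof (rule sum.mono_neutral_left)
  show "\<forall>i\<in>{..<Q} - {..n}. (if n \<in> {N i..<M i} then 2 ^ i else 0) = (0::real)"
  proof
    fix i assume "i \<in> {..<Q} - {..n}"
    then show "(if n \<in> {N i..<M i} then 2 ^ i else 0) = (0::real)" using assms(1)[of i] by simp
  qed
qed (use assms(2) in auto)

lemma blocks_ordered:
  fixes N M :: "nat \<Rightarrow> nat"
  assumes "\<And>i. N i \<le> M i" "\<And>i. M i \<le> N (Suc i)" "i < j"
  shows "M i \<le> N j"
proof -
  have step: "N k \<le> N (Suc k)" for k using assms(1,2)[of k] by simp
  have "N (Suc i) \<le> N j"
    using assms(3) by (intro lift_Suc_mono_le[of N, OF step]) simp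
  then show ?thesis using assms(2)[of i] by simp
qed

lemma block_weight_in:
  assumes NM: "\<And>i. N i \<le> M i" "\<And>i. M i \<le> N (Suc i)" and N: "\<And>i. i \<le> N i"
    and n: "n \<in> {N j..<M j}"
  shows "block_weight N M n = 2 ^ j"
proof -
  have "n \<in> {N i..<M i} \<longleftrightarrow> i = j" for i
    using n blocks_ordered[of N M, OF NM, of i j] blocks_ordered[of N M, OF NM, of j i]
    by (cases i j rule: linorder_cases) auto
  then have "(if n \<in> {N i..<M i} then 2 ^ i else 0) = (if i = j then 2 ^ j else (0::real))" for i
    by metis
  then have "block_weight N M n = (\<Sum>i\<le>n. if i = j then 2 ^ j else 0)"
    unfolding block_weight_def by (rule sum.cong[OF refl])
  moreover have "j \<le> n" using n N[of j] by simp
  ultimately show ?thesis by simp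
qed

lemma block_weight_nonzeroD: "block_weight N M n \<noteq> 0 \<Longrightarrow> \<exists>i. n \<in> {N i..<M i}"
  unfolding block_weight_def by (metis (mono_tags, lifting) sum.neutral)

text \<open>The series of \<open>w\<close> may converge only conditionally, so norms are taken of
  sums over whole intervals. The \<open>i\<close>-th block meets \<open>{m..<n}\<close> in an
  interval beyond \<open>N i\<close>, which contributes at most \<open>2 ^ i * (1/4) ^ i\<close>;
  beyond \<open>N j\<close> the earlier blocks contribute nothing.\<close>

lemma summable_block_weight:
  fixes w :: "nat \<Rightarrow> 'a::banach"
  assumes NM: "\<And>i. N i \<le> M i" "\<And>i. M i \<le> N (Suc i)" and N: "\<And>i. i \<le> N i"
    and tail: "\<And>j p q. N j \<le> p \<Longrightarrow> norm (sum w {p..<q}) \<le> (1/4) ^ j"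
  shows "summable (\<lambda>n. block_weight N M n *\<^sub>R w n)"
  unfolding summable_Cauchy
proof (intro allI impI)
  fix \<epsilon> :: real assume \<epsilon>: "0 < \<epsilon>"
  obtain j where j: "(1/2) ^ j < \<epsilon> / 2" using real_arch_pow_inv[of "\<epsilon>/2" "1/2"] \<epsilon> by auto
  have "norm (\<Sum>k\<in>{m..<n}. block_weight N M k *\<^sub>R w k) < \<epsilon>" if m: "N j \<le> m" for m n
  proof -
    have piece: "norm (\<Sum>k\<in>{m..<n}. (if k \<in> {N i..<M i} then 2 ^ i else 0) *\<^sub>R w k)
        \<le> (if i < j then 0 else (1/2) ^ i)" for i
    proof -
      let ?I = "{max m (N i)..<min n (M i)}"
      have "(\<Sum>k\<in>{m..<n}. (if k \<in> {N i..<M i} then 2 ^ i else 0) *\<^sub>R w k)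
          = (\<Sum>k\<in>?I. 2 ^ i *\<^sub>R w k)"
        by (rule sum.mono_neutral_cong_right) auto
      also have "\<dots> = 2 ^ i *\<^sub>R sum w ?I" by (simp add: scaleR_sum_right)
      finally have eq: "norm (\<Sum>k\<in>{m..<n}. (if k \<in> {N i..<M i} then 2 ^ i else 0) *\<^sub>R w k)
          = 2 ^ i * norm (sum w ?I)" by simp
      show ?thesis
      proof (cases "i < j")
        case True
        then have "?I = {}" using blocks_ordered[of N M, OF NM True] m by auto
        then have "sum w ?I = 0" by (simp only: sum.empty)
        then show ?thesis using eq True by simp
      next
        case False
        have "2 ^ i * norm (sum w ?I) \<le> 2 ^ i * (1/4) ^ i"
          by (intro mult_left_mono tail) auto
        also have "\<dots> = (1/2) ^ i" by (simp flip: power_mult_distrib)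
        finally show ?thesis using eq False by simp
      qed
    qed
    have "(\<Sum>k\<in>{m..<n}. block_weight N M k *\<^sub>R w k)
        = (\<Sum>k\<in>{m..<n}. \<Sum>i<n. (if k \<in> {N i..<M i} then 2 ^ i else 0) *\<^sub>R w k)"
    proof (rule sum.cong[OF refl])
      fix k assume "k \<in> {m..<n}"
      then have "block_weight N M k = (\<Sum>i<n. if k \<in> {N i..<M i} then 2 ^ i else 0)"
        by (intro block_weight_eq_sum N) simp
      then show "block_weight N M k *\<^sub>R w k
          = (\<Sum>i<n. (if k \<in> {N i..<M i} then 2 ^ i else 0) *\<^sub>R w k)"
        by (simp only: scaleR_sum_left)
    qed
    also have "\<dots> = (\<Sum>i<n. \<Sum>k\<in>{m..<n}. (if k \<in> {N i..<M i} then 2 ^ i else 0) *\<^sub>R w k)"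
      by (rule sum.swap)
    finally have "norm (\<Sum>k\<in>{m..<n}. block_weight N M k *\<^sub>R w k)
        \<le> (\<Sum>i<n. if i < j then 0 else (1/2) ^ i)"
      using piece by (simp only: sum_norm_le)
    also have "\<dots> = (\<Sum>i\<in>{j..<n}. (1/2) ^ i)"
      by (rule sum.mono_neutral_cong_right) auto
    also have "\<dots> \<le> 2 * (1/2) ^ j" by (rule sum_half_powers_le)
    also have "\<dots> < \<epsilon>" using j by simp
    finally show ?thesis .
  qed
  then show "\<exists>K. \<forall>m\<ge>K. \<forall>n. norm (\<Sum>k\<in>{m..<n}. block_weight N M k *\<^sub>R w k) < \<epsilon>" by blast
qed

section \<open>Greedy sums of tails\<close>

definition greedy_sums :: "(nat \<Rightarrow> 'a::banach_lattice) \<Rightarrow> (nat \<Rightarrow> real) \<Rightarrow> 'a set" where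
  "greedy_sums b c = (\<lambda>B. \<Sum>n\<in>B. c n *\<^sub>R b n) ` {B. greedy_set (\<lambda>n. \<bar>c n\<bar>) B}"

definition tail :: "nat \<Rightarrow> (nat \<Rightarrow> real) \<Rightarrow> nat \<Rightarrow> real" where
  "tail N c n = (if n < N then 0 else c n)"

lemma greedy_set_tail_subset:
  assumes "greedy_set (\<lambda>n. \<bar>tail N c n\<bar>) B"
  shows "B \<subseteq> {N..}"
proof
  fix n assume "n \<in> B"
  then have "0 < \<bar>tail N c n\<bar>" using assms by (simp add: greedy_set_def)
  then show "n \<in> {N..}" by (simp add: tail_def split: if_splits)
qed

text \<open>Failure of domination is witnessed by finitely many greedy sets, all finite, so a single
  bound \<open>M\<close> encloses them in a block. The hump is stated with \<open>c\<close> because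
  the tail agrees with \<open>c\<close> there.\<close>

lemma tail_greedy_sums_hump:
  assumes "\<not> fin_dominated \<delta> (greedy_sums b (tail N c))"
  obtains R M where "N \<le> M" "finite R" "\<And>B. B \<in> R \<Longrightarrow> greedy_set (\<lambda>n. \<bar>tail N c n\<bar>) B \<and> B \<subseteq> {N..<M}"
    "\<And>v. (\<And>B. B \<in> R \<Longrightarrow> \<bar>\<Sum>n\<in>B. c n *\<^sub>R b n\<bar> \<le> v) \<Longrightarrow> \<delta> < norm v"
proof -
  from assms[unfolded greedy_sums_def] obtain R where
    R: "finite R" "R \<subseteq> {B. greedy_set (\<lambda>n. \<bar>tail N c n\<bar>) B}" and
    hump: "\<And>v. (\<And>B. B \<in> R \<Longrightarrow> \<bar>\<Sum>n\<in>B. tail N c n *\<^sub>R b n\<bar> \<le> v) \<Longrightarrow> \<delta> < norm v"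
    by (rule not_fin_dominated_image) blast
  have "finite (\<Union>R)" using R by (auto simp: greedy_set_def)
  then obtain M0 where M0: "\<forall>n\<in>\<Union>R. n < M0" by (auto simp: finite_nat_set_iff_bounded)
  have M0: "B \<subseteq> {..<max N M0}" if "B \<in> R" for B
    using that M0 by (auto simp: less_max_iff_disj)
  have "greedy_set (\<lambda>n. \<bar>tail N c n\<bar>) B" if "B \<in> R" for B using R(2) that by auto
  then have "B \<subseteq> {N..}" if "B \<in> R" for B using that greedy_set_tail_subset by metis
  with M0 have M: "B \<subseteq> {N..<max N M0}" if "B \<in> R" for B
    using that unfolding atLeastLessThan_def by (metis Int_subset_iff)
  have "(\<Sum>n\<in>B. tail N c n *\<^sub>R b n) = (\<Sum>n\<in>B. c n *\<^sub>R b n)" if "B \<in> R" for B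
    using M[OF that] by (intro sum.cong) (auto simp: tail_def)
  then have "\<delta> < norm v" if "\<And>B. B \<in> R \<Longrightarrow> \<bar>\<Sum>n\<in>B. c n *\<^sub>R b n\<bar> \<le> v" for v
    using that by (intro hump) simp
  with R M show ?thesis by (intro that[of "max N M0" R]) auto
qed

lemma tail_sums_small:
  fixes w :: "nat \<Rightarrow> 'a::banach"
  assumes "summable w" "0 < \<epsilon>"
  shows "\<forall>\<^sub>F K in sequentially. \<forall>p q. K \<le> p \<longrightarrow> norm (sum w {p..<q}) \<le> \<epsilon>"
proof -
  obtain K where "\<And>p q. K \<le> p \<Longrightarrow> norm (sum w {p..<q}) < \<epsilon>"
    using assms unfolding summable_Cauchy by blast
  then have "norm (sum w {p..<q}) \<le> \<epsilon>" if "K \<le> p" for p q using that less_imp_le by blast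
  then show ?thesis unfolding eventually_sequentially by (meson order_trans)
qed

text \<open>Amplification by \<open>s\<close> of late coefficients must not let them overtake the
  nonzero early ones.\<close>

lemma separated_tail:
  fixes c :: "nat \<Rightarrow> real"
  assumes "c \<longlonglongrightarrow> 0" "0 < s"
  shows "\<forall>\<^sub>F K in sequentially. \<forall>n\<ge>K. \<forall>m<M. c m \<noteq> 0 \<longrightarrow> s * \<bar>c n\<bar> < \<bar>c m\<bar>"
proof -
  have "\<forall>\<^sub>F K in sequentially. \<forall>n\<ge>K. s * \<bar>c n\<bar> < \<bar>c m\<bar>" if "c m \<noteq> 0" for m
  proof -
    have "(\<lambda>n. s * \<bar>c n\<bar>) \<longlonglongrightarrow> s * 0" using assms(1) tendsto_rabs_zero by (intro tendsto_intros) blast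
    then have "\<forall>\<^sub>F n in sequentially. s * \<bar>c n\<bar> < \<bar>c m\<bar>"
      using that by (intro order_tendstoD(2)) auto
    then show ?thesis by (rule eventually_all_ge_at_top)
  qed
  then have "\<forall>\<^sub>F K in sequentially. \<forall>m\<in>{..<M}. c m \<noteq> 0 \<longrightarrow> (\<forall>n\<ge>K. s * \<bar>c n\<bar> < \<bar>c m\<bar>)"
    by (intro eventually_ball_finite) (auto simp: eventually_sequentially)
  then show ?thesis by eventually_elim blast
qed

text \<open>If the conclusion fails, then beyond every \<open>N\<close> there is a block of the expansion of \<open>x\<close> whose
  greedy sums have a finite supremum of norm greater than \<open>\<delta>\<close>. Amplify the \<open>j\<close>-th of a sparse
  sequence of such blocks by \<open>2 ^ j\<close>. The tails of \<open>x\<close> are so small that the result \<open>y\<close> still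
  converges and its blocks are separated in size, so that every greedy sum of a block is a
  difference of two greedy sums of \<open>y\<close>; this makes \<open>y\<close> violate \<open>dom\<close>. Working with blocks of
  a single \<open>x\<close> avoids any use of the continuity of the coefficient functionals.\<close>

lemma gliding_hump:
  fixes b :: "nat \<Rightarrow> 'a::banach_lattice"
  assumes E: "subspace E" "closed E" and b: "schauder_basis E b"
    and dom: "\<And>y. y \<in> E \<Longrightarrow> \<exists>C. fin_dominated C (greedy_sums b (\<lambda>n. coef b n y))"
    and x: "x \<in> E" and lim: "(\<lambda>n. coef b n x) \<longlonglongrightarrow> 0" and \<delta>: "0 < \<delta>"
  shows "\<exists>N\<ge>N\<^sub>1. fin_dominated \<delta> (greedy_sums b (tail N (\<lambda>n. coef b n x)))"
proof (rule ccontr)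
  define c where "c = (\<lambda>n. coef b n x)"
  define w where "w = (\<lambda>n. c n *\<^sub>R b n)"
  define hump where "hump = (\<lambda>N R M. N \<le> M \<and> finite R
      \<and> (\<forall>B\<in>R. greedy_set (\<lambda>n. \<bar>tail N c n\<bar>) B \<and> B \<subseteq> {N..<M})
      \<and> (\<forall>v. (\<forall>B\<in>R. \<bar>sum w B\<bar> \<le> v) \<longrightarrow> \<delta> < norm v))"
  assume "\<not> ?thesis"
  then have neg: "\<not> fin_dominated \<delta> (greedy_sums b (tail N c))" if "N\<^sub>1 \<le> N" for N
    using that by (auto simp: c_def)
  have "\<exists>R M. hump N R M" if "N\<^sub>1 \<le> N" for N
    using tail_greedy_sums_hump[OF neg[OF that]] unfolding hump_def w_def by (metis (no_types, lifting))
  then obtain R M where RM: "\<And>N. N\<^sub>1 \<le> N \<Longrightarrow> hump N (R N) (M N)" by metis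
  have sumw: "summable w" using coef_sums[OF b x] sums_summable by (auto simp: w_def c_def)
  \<comment> \<open>Tails of size \<open>(1/4) ^ j\<close> tolerate the weight \<open>2 ^ j\<close>,
    and \<open>j \<le> N\<close> is what the truncation in \<open>block_weight\<close> requires. In
    \<open>?Q\<close>, \<open>M N \<le> N'\<close> keeps the blocks disjoint; the exponent is
    \<open>Suc j\<close> because that is the weight of the block starting at
    \<open>N'\<close>.\<close>
  let ?P = "\<lambda>j N. N\<^sub>1 \<le> N \<and> j \<le> N \<and> (\<forall>p q. N \<le> p \<longrightarrow> norm (sum w {p..<q}) \<le> (1/4) ^ j)"
  let ?Q = "\<lambda>j N N'. M N \<le> N' \<and> (\<forall>n\<ge>N'. \<forall>m<M N. c m \<noteq> 0 \<longrightarrow> 2 ^ Suc j * \<bar>c n\<bar> < \<bar>c m\<bar>)"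
  have base: "\<exists>N. ?P 0 N"
  proof -
    have "\<forall>\<^sub>F N in sequentially. ?P 0 N"
      using tail_sums_small[OF sumw, of "(1/4)^0"]
      by (intro eventually_conj eventually_ge_at_top) auto
    then show ?thesis by (rule eventually_happens'[OF sequentially_bot])
  qed
  have step: "\<exists>N'. ?P (Suc j) N' \<and> ?Q j N N'" if "?P j N" for j N
  proof -
    have "\<forall>\<^sub>F N' in sequentially. ?P (Suc j) N'"
      using tail_sums_small[OF sumw, of "(1/4)^Suc j"]
      by (intro eventually_conj eventually_ge_at_top) auto
    moreover have "\<forall>\<^sub>F N' in sequentially. ?Q j N N'"
      using separated_tail[of c "2 ^ Suc j" "M N"] lim
      by (intro eventually_conj eventually_ge_at_top) (auto simp: c_def)
    ultimately have "\<forall>\<^sub>F N' in sequentially. ?P (Suc j) N' \<and> ?Q j N N'"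
      by (rule eventually_conj)
    then show ?thesis by (rule eventually_happens'[OF sequentially_bot])
  qed
  have "\<exists>N. \<forall>j. ?P j (N j) \<and> ?Q j (N j) (N (Suc j))"
    by (rule dependent_nat_choice[of ?P ?Q, OF base step])
  then obtain N where PN: "\<And>j. ?P j (N j)" and QN: "\<And>j. ?Q j (N j) (N (Suc j))" by blast
  have N1: "N\<^sub>1 \<le> N j" and Nj: "j \<le> N j" for j using PN[of j] by simp_all
  have tails: "norm (sum w {p..<q}) \<le> (1/4) ^ j" if "N j \<le> p" for j p q
    using PN[of j] that by simp
  have MN: "M (N j) \<le> N (Suc j)" for j using QN[of j] by simp
  have sep: "2 ^ Suc j * \<bar>c n\<bar> < \<bar>c m\<bar>" if "N (Suc j) \<le> n" "m < M (N j)" "c m \<noteq> 0" for j n m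
    using QN[of j] that by simp
  define \<mu> where "\<mu> = (\<lambda>j. M (N j))"
  have hump: "hump (N j) (R (N j)) (\<mu> j)" for j unfolding \<mu>_def by (rule RM[OF N1])
  have NM: "N i \<le> \<mu> i" and M\<mu>: "\<mu> i \<le> N (Suc i)" for i
    using hump[of i] MN[of i] by (auto simp: hump_def \<mu>_def)
  define r where "r = block_weight N \<mu>"
  have r: "r n = 2 ^ j" if "n \<in> {N j..<\<mu> j}" for n j
    unfolding r_def by (rule block_weight_in[OF NM M\<mu> Nj that])
  have r_nz: "\<exists>i. n \<in> {N i..<\<mu> i}" if "r n \<noteq> 0" for n
    using that unfolding r_def by (rule block_weight_nonzeroD)
  have "summable (\<lambda>n. r n *\<^sub>R w n)"
    unfolding r_def by (rule summable_block_weight[OF NM M\<mu> Nj tails])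
  then obtain y where y: "(\<lambda>n. r n *\<^sub>R w n) sums y" by (auto simp: summable_def)
  have "b n \<in> E" for n using b by (auto simp: schauder_basis_def)
  then have "(\<Sum>n<k. r n *\<^sub>R w n) \<in> E" for k
    using E(1) by (intro subspace_sum) (auto simp: w_def subspace_scale)
  then have yE: "y \<in> E"
    by (rule closed_sequentially[OF E(2)]) (use y in \<open>simp add: sums_def\<close>)
  have coef: "coef b n y = r n * c n" for n
    using y by (intro coef_eqI[OF b yE]) (simp add: w_def)
  define d where "d = (\<lambda>n. r n * c n)"
  obtain C where C: "fin_dominated C (greedy_sums b d)"
    using dom[OF yE] by (auto simp: coef d_def)
  have bigger: "\<bar>d n\<bar> < \<bar>d m\<bar>"
    if m: "m \<in> {N i..<\<mu> i}" "d m \<noteq> 0" and n: "n \<in> {N j..<\<mu> j}" and "i < j" for i j m n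
  proof -
    \<comment> \<open>The gap is arranged between consecutive stages, but stage \<open>k\<close>
      covers all \<open>m < M (N k)\<close> and with them every earlier block. The weight on
      \<open>c m\<close> only widens the gap.\<close>
    obtain k where k: "j = Suc k" "i \<le> k" using \<open>i < j\<close> by (cases j) auto
    have "m < M (N k)"
    proof (cases "i = k")
      case False
      then have "\<mu> i \<le> N k" using k by (intro blocks_ordered[of N \<mu>, OF NM M\<mu>]) simp
      also have "\<dots> \<le> \<mu> k" by (rule NM)
      finally show ?thesis using m by (simp add: \<mu>_def)
    qed (use m in \<open>simp add: \<mu>_def\<close>)
    then have "2 ^ j * \<bar>c n\<bar> < \<bar>c m\<bar>"
      using sep[of k n m] m n k by (simp add: d_def)
    also have "\<dots> \<le> 2 ^ i * \<bar>c m\<bar>" by (simp add: mult_le_cancel_right1)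
    finally show ?thesis using r[OF m(1)] r[OF n] by (simp add: d_def abs_mult)
  qed
  \<comment> \<open>A bound \<open>C\<close> for greedy sums of \<open>y\<close> becomes
    \<open>2 * C / 2 ^ j\<close> for the original block, the 2 coming from a difference of two such
    sums. This \<open>j\<close> brings it below \<open>\<delta>\<close>.\<close>
  obtain j where j: "2 * C / \<delta> < 2 ^ j" using real_arch_pow[of 2 "2 * C / \<delta>"] by auto
  \<comment> \<open>The active indices of the earlier blocks. By \<open>bigger\<close> they precede
    everything else, so \<open>A\<close> and \<open>A \<union> B\<close> are both greedy for
    \<open>d\<close> and their difference isolates \<open>B\<close>.\<close>
  define A where "A = {n. n < N j \<and> d n \<noteq> 0}"
  have before: "precedes (\<lambda>n. \<bar>d n\<bar>) n m" if n: "n \<in> A" and m: "m \<notin> A" for n m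
  proof (cases "d m = 0")
    case False
    then obtain i where i: "m \<in> {N i..<\<mu> i}" using r_nz[of m] by (auto simp: d_def)
    obtain k where k: "n \<in> {N k..<\<mu> k}" using r_nz[of n] n by (auto simp: A_def d_def)
    have "N j \<le> m" using m False by (auto simp: A_def)
    then have "\<not> i < j" using blocks_ordered[of N \<mu> i j, OF NM M\<mu>] i by auto
    moreover have "k < j"
    proof (rule ccontr)
      assume "\<not> k < j"
      then have "N j \<le> N k"
        using blocks_ordered[of N \<mu> j k, OF NM M\<mu>] NM[of j] by (cases "j = k") auto
      then show False using k n by (auto simp: A_def)
    qed
    ultimately have "\<bar>d m\<bar> < \<bar>d n\<bar>"
      using n by (intro bigger[OF k _ i]) (auto simp: A_def)
    then show ?thesis by (simp add: precedes_def)
  qed (use n in \<open>simp add: precedes_def A_def\<close>)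
  have finA: "finite A" by (simp add: A_def)
  then have greedyA: "greedy_set (\<lambda>n. \<bar>d n\<bar>) A"
    using before by (auto simp: greedy_set_def A_def)
  have B: "greedy_set (\<lambda>n. \<bar>tail (N j) c n\<bar>) B" "B \<subseteq> {N j..<\<mu> j}" if "B \<in> R (N j)" for B
    using hump[of j] that by (auto simp: hump_def)
  have greedyB: "greedy_set (\<lambda>n. \<bar>d n\<bar>) (A \<union> B)" if BR: "B \<in> R (N j)" for B
  proof -
    have pos: "0 < \<bar>d n\<bar>" if "n \<in> B" for n
    proof -
      have "0 < \<bar>tail (N j) c n\<bar>" using B(1)[OF BR] that by (simp add: greedy_set_def)
      then show ?thesis using r[of n j] B(2)[OF BR] that by (auto simp: d_def tail_def split: if_splits)
    qed
    have "precedes (\<lambda>n. \<bar>d n\<bar>) n m" if n: "n \<in> B" and m: "m \<notin> A" "m \<notin> B" for n m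
    proof (cases "d m = 0")
      case False
      then obtain i where i: "m \<in> {N i..<\<mu> i}" using r_nz[of m] by (auto simp: d_def)
      have nj: "n \<in> {N j..<\<mu> j}" using B(2)[OF BR] n by blast
      have Njm: "N j \<le> m" using m False by (auto simp: A_def)
      then have "j \<le> i" using blocks_ordered[of N \<mu> i j, OF NM M\<mu>] i by fastforce
      then consider "j < i" | "i = j" by linarith
      then show ?thesis
      proof cases
        case 1
        then show ?thesis using bigger[OF nj _ i] pos[OF n] by (simp add: precedes_def)
      next
        case 2
        \<comment> \<open>Inside one block all coefficients carry the same factor
          \<open>2 ^ j\<close>, so \<open>d\<close> orders them as \<open>c\<close> does.\<close>
        have "precedes (\<lambda>n. \<bar>tail (N j) c n\<bar>) n m"
          using B(1)[OF BR] n m by (simp add: greedy_set_def)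
        then show ?thesis using r[OF nj] r[OF i] 2 nj Njm
          by (auto simp: precedes_def tail_def d_def abs_mult)
      qed
    qed (use pos[OF n] in \<open>simp add: precedes_def\<close>)
    moreover have "finite B" using B(1)[OF BR] by (simp add: greedy_set_def)
    ultimately show ?thesis using greedyA pos unfolding greedy_set_def by blast
  qed
  let ?F = "\<lambda>B. \<Sum>n\<in>B. d n *\<^sub>R b n"
  \<comment> \<open>Including \<open>A\<close> itself yields one \<open>v\<close> above both terms
    of every difference.\<close>
  have "finite (insert (?F A) ((\<lambda>B. ?F (A \<union> B)) ` R (N j)))"
    using hump[of j] by (simp add: hump_def)
  moreover have "insert (?F A) ((\<lambda>B. ?F (A \<union> B)) ` R (N j)) \<subseteq> greedy_sums b d"
    using greedyA greedyB by (auto simp: greedy_sums_def)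
  ultimately obtain v where v: "norm v \<le> C" "\<bar>?F A\<bar> \<le> v" "\<And>B. B \<in> R (N j) \<Longrightarrow> \<bar>?F (A \<union> B)\<bar> \<le> v"
    using C unfolding fin_dominated_def by (metis (no_types, lifting) image_eqI insertCI)
  have "\<bar>sum w B\<bar> \<le> (2 / 2 ^ j) *\<^sub>R v" if BR: "B \<in> R (N j)" for B
  proof -
    have "finite B" "A \<inter> B = {}"
      using B[OF BR] by (auto simp: greedy_set_def A_def)
    then have "?F (A \<union> B) = ?F A + ?F B" using finA by (simp add: sum.union_disjoint)
    moreover have "?F B = 2 ^ j *\<^sub>R sum w B"
      unfolding w_def scaleR_sum_right using B(2)[OF BR] r[of _ j]
      by (intro sum.cong) (auto simp: d_def)
    ultimately have "2 ^ j *\<^sub>R sum w B = ?F (A \<union> B) - ?F A" by simp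
    then have "2 ^ j *\<^sub>R \<bar>sum w B\<bar> = \<bar>?F (A \<union> B) - ?F A\<bar>"
      by (simp flip: abs_scaleR_nonneg)
    also have "\<dots> \<le> \<bar>?F (A \<union> B)\<bar> + \<bar>?F A\<bar>" by (rule abs_triangle_ineq4)
    also have "\<dots> \<le> v + v" using v BR by (intro add_mono) auto
    finally have "(1 / 2 ^ j) *\<^sub>R (2 ^ j *\<^sub>R \<bar>sum w B\<bar>) \<le> (1 / 2 ^ j) *\<^sub>R (2 *\<^sub>R v)"
      by (intro scaleR_left_mono) (auto simp: scaleR_2)
    then show ?thesis by simp
  qed
  then have "\<delta> < norm ((2 / 2 ^ j) *\<^sub>R v)"
    using hump[of j] unfolding hump_def by blast
  moreover have "norm ((2 / 2 ^ j) *\<^sub>R v) \<le> (2 / 2 ^ j) * C"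
    using v(1) by (simp add: divide_right_mono)
  moreover have "(2 / 2 ^ j) * C < \<delta>" using j \<delta> by (simp add: field_simps)
  ultimately show False by simp
qed

subsection \<open>Uniform convergence of greedy sums\<close>

lemma top_set_eventually_contains:
  "\<forall>\<^sub>F m in sequentially. {n. n < N \<and> 0 < h n} \<subseteq> top_set h m"
proof -
  have "\<forall>\<^sub>F m in sequentially. \<forall>n\<in>{..<N}. 0 < h n \<longrightarrow> n \<in> top_set h m"
  proof (rule eventually_ball_finite)
    show "\<forall>n\<in>{..<N}. \<forall>\<^sub>F m in sequentially. 0 < h n \<longrightarrow> n \<in> top_set h m"
    proof
      fix n
      show "\<forall>\<^sub>F m in sequentially. 0 < h n \<longrightarrow> n \<in> top_set h m"
        using eventually_gt_at_top[of "card {j. precedes h j n}"]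
        by eventually_elim (simp add: top_set_def)
    qed
  qed simp
  then show ?thesis by eventually_elim auto
qed

text \<open>Below \<open>N\<close> the tail vanishes, so those indices lose to every remaining
  member of \<open>B\<close>; from \<open>N\<close> on the order is unchanged.\<close>

lemma greedy_set_Diff_initial:
  assumes B: "greedy_set (\<lambda>n. \<bar>c n\<bar>) B"
    and sub: "{n. n < N \<and> 0 < \<bar>c n\<bar>} \<subseteq> B"
  shows "greedy_set (\<lambda>n. \<bar>tail N c n\<bar>) (B - {..<N})"
  unfolding greedy_set_def
proof (intro conjI ballI allI impI)
  show "finite (B - {..<N})" using B by (simp add: greedy_set_def)
  fix i assume i: "i \<in> B - {..<N}"
  then have ci: "0 < \<bar>c i\<bar>" "tail N c i = c i" using B by (auto simp: greedy_set_def tail_def)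
  then show "0 < \<bar>tail N c i\<bar>" by simp
  fix j assume j: "j \<notin> B - {..<N}"
  show "precedes (\<lambda>n. \<bar>tail N c n\<bar>) i j"
  proof (cases "j < N")
    case True
    then show ?thesis using ci by (simp add: precedes_def tail_def)
  next
    case False
    then have "precedes (\<lambda>n. \<bar>c n\<bar>) i j" using B i j by (auto simp: greedy_set_def)
    then show ?thesis using ci False by (simp add: precedes_def tail_def)
  qed
qed

text \<open>Since the lattice need not be \<open>\<sigma>\<close>-complete, the tails are dominated on finite blocks
  of indices only, where suprema exist.\<close>

lemma converges_uniformly_blocks:
  fixes f :: "nat \<Rightarrow> 'a::banach_lattice"
  assumes M: "strict_mono M" and z0: "\<And>j. 0 \<le> z j" and z: "\<And>j. norm (z j) \<le> 2 * (1/4) ^ j"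
    and f: "\<And>j m. M j \<le> m \<Longrightarrow> m < M (Suc j) \<Longrightarrow> \<bar>f m - x\<bar> \<le> z j"
  shows "converges_uniformly f x"
proof -
  \<comment> \<open>The weight \<open>2 ^ j\<close> is paid for by the bound on \<open>z j\<close>
    and gives \<open>z i\<close> at most \<open>(1/2) ^ i\<close> times the sum, which is the
    smallness relative to a fixed element that uniform convergence demands.\<close>
  have "summable (\<lambda>j. 2 ^ j *\<^sub>R z j)"
  proof (rule summable_comparison_test')
    show "summable (\<lambda>j. 2 * (1/2 :: real) ^ j)" by (intro summable_mult summable_geometric) simp
    fix j
    have "norm (2 ^ j *\<^sub>R z j) \<le> 2 ^ j * (2 * (1/4) ^ j)"
      using z[of j] by simp
    also have "\<dots> = 2 * (1/2) ^ j"
      by (simp add: mult.left_commute[of _ 2] flip: power_mult_distrib)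
    finally show "norm (2 ^ j *\<^sub>R z j) \<le> 2 * (1/2) ^ j" .
  qed
  then have zu: "2 ^ j *\<^sub>R z j \<le> (\<Sum>j. 2 ^ j *\<^sub>R z j)" (is "_ \<le> ?u") for j
    using z0 by (intro term_le_suminf[of "\<lambda>j. 2 ^ j *\<^sub>R z j"]) (auto simp: scaleR_nonneg_nonneg)
  have u0: "0 \<le> ?u" using zu[of 0] z0[of 0] by simp
  show ?thesis unfolding converges_uniformly_def
  proof (rule exI[of _ ?u], intro allI impI)
    fix \<epsilon> :: real assume \<epsilon>: "0 < \<epsilon>"
    obtain j where j: "(1/2) ^ j < \<epsilon>" using real_arch_pow_inv[OF \<epsilon>, of "1/2"] by auto
    have "\<bar>f m - x\<bar> \<le> \<epsilon> *\<^sub>R ?u" if m: "M j \<le> m" for m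
    proof -
      have "m < M (Suc m)" using seq_suble[OF M, of "Suc m"] by simp
      \<comment> \<open>The number of the block that contains \<open>m\<close>; \<open>M\<close>
        exceeds every bound, so it exists.\<close>
      define i where "i = (LEAST i. m < M (Suc i))"
      have mi: "m < M (Suc i)" unfolding i_def by (rule LeastI) fact
      have "j \<le> i"
      proof (rule ccontr)
        assume "\<not> j \<le> i"
        then have "M (Suc i) \<le> M j" using M by (simp add: strict_mono_less_eq)
        then show False using mi m by simp
      qed
      have "M i \<le> m"
      proof (cases i)
        case 0
        then show ?thesis using \<open>j \<le> i\<close> m by simp
      next
        case (Suc k)
        then have "\<not> m < M (Suc k)" unfolding i_def using not_less_Least lessI by metis
        then show ?thesis using Suc by simp
      qed
      then have "\<bar>f m - x\<bar> \<le> z i" using mi by (rule f)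
      also have "z i = (1/2) ^ i *\<^sub>R (2 ^ i *\<^sub>R z i)" by (simp flip: power_mult_distrib)
      also have "\<dots> \<le> (1/2) ^ i *\<^sub>R ?u" using zu by (intro scaleR_left_mono) auto
      also have "\<dots> \<le> \<epsilon> *\<^sub>R ?u"
      proof (rule scaleR_right_mono[OF _ u0])
        have "(1/2 :: real) ^ i \<le> (1/2) ^ j" using \<open>j \<le> i\<close> by (intro power_decreasing) auto
        then show "(1/2) ^ i \<le> \<epsilon>" using j by linarith
      qed
      finally show ?thesis .
    qed
    then show "\<exists>m0. \<forall>m\<ge>m0. \<bar>f m - x\<bar> \<le> \<epsilon> *\<^sub>R ?u" by blast
  qed
qed

text \<open>\<open>dom\<close> gives constants without any decay. \<open>gliding_hump\<close> turns
  them into bounds \<open>(1/4) ^ j\<close> for suitable tails of a fixed \<open>x\<close>, and the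
  indices \<open>m\<close> are grouped by the tail against which their greedy sum is
  measured.\<close>

lemma uniformly_quasi_greedyI:
  fixes b :: "nat \<Rightarrow> 'a::banach_lattice"
  assumes E: "subspace E" "closed E" and b: "schauder_basis E b"
    and c0: "0 < c0" "\<And>n. c0 \<le> norm (b n)"
    and dom: "\<And>y. y \<in> E \<Longrightarrow> \<exists>C. fin_dominated C (greedy_sums b (\<lambda>n. coef b n y))"
  shows "uniformly_quasi_greedy E b"
  unfolding uniformly_quasi_greedy_def
proof
  fix x assume x: "x \<in> E"
  define c where "c = (\<lambda>n. coef b n x)"
  define w where "w = (\<lambda>n. c n *\<^sub>R b n)"
  define h where "h = (\<lambda>n. \<bar>c n\<bar>)"
  have lim: "h \<longlonglongrightarrow> 0" unfolding h_def c_def by (rule coef_tendsto_0[OF b x c0])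
  then have limc: "(\<lambda>n. coef b n x) \<longlonglongrightarrow> 0"
    unfolding h_def c_def by (simp add: tendsto_rabs_zero_iff)
  have sums: "w sums x" using coef_sums[OF b x] by (simp add: w_def c_def)
  let ?S = "\<lambda>N. sum w {..<N}"
  let ?F = "\<lambda>m. sum w (top_set h m)"
  have "\<exists>N. fin_dominated ((1/4) ^ j) (greedy_sums b (tail N c)) \<and> norm (x - ?S N) \<le> (1/4) ^ j" for j
  proof -
    have "\<forall>\<^sub>F N in sequentially. dist (?S N) x < (1/4) ^ j"
      using sums unfolding sums_def by (intro tendstoD) auto
    then obtain N1 where N1: "\<And>N. N1 \<le> N \<Longrightarrow> dist (?S N) x < (1/4) ^ j"
      by (auto simp: eventually_sequentially)
    obtain N where "N1 \<le> N" "fin_dominated ((1/4) ^ j) (greedy_sums b (tail N c))"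
      using gliding_hump[OF E b dom x limc, of "(1/4) ^ j" N1] by (auto simp: c_def)
    moreover from this have "norm (x - ?S N) \<le> (1/4) ^ j"
      using N1[of N] by (simp add: dist_norm norm_minus_commute)
    ultimately show ?thesis by blast
  qed
  then obtain N where N: "\<And>j. fin_dominated ((1/4) ^ j) (greedy_sums b (tail (N j) c))"
      "\<And>j. norm (x - ?S (N j)) \<le> (1/4) ^ j"
    by metis
  \<comment> \<open>Once a greedy set holds all nonzero indices below \<open>N j\<close>,
    subtracting the partial sum up to \<open>N j\<close> leaves a greedy sum of the tail.\<close>
  let ?P = "\<lambda>j M. \<forall>m\<ge>M. {n. n < N j \<and> 0 < h n} \<subseteq> top_set h m"
  have P: "\<exists>M\<ge>k. ?P j M" for j k
  proof -
    have "\<forall>\<^sub>F M in sequentially. k \<le> M \<and> ?P j M"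
      using eventually_ge_at_top[of k] eventually_all_ge_at_top[OF top_set_eventually_contains]
      by (rule eventually_conj)
    then show ?thesis by (rule eventually_happens'[OF sequentially_bot])
  qed
  have base: "\<exists>M. ?P 0 M" using P[of 0 0] by blast
  have step: "\<exists>M'. ?P (Suc j) M' \<and> M < M'" if "?P j M" for j M
    using P[of "Suc M" "Suc j"] by (metis Suc_le_lessD)
  have "\<exists>M. \<forall>j. ?P j (M j) \<and> M j < M (Suc j)"
    by (rule dependent_nat_choice[of ?P "\<lambda>j M M'. M < M'", OF base step])
  then obtain M where M: "\<And>j. ?P j (M j)" "\<And>j. M j < M (Suc j)" by blast
  have tail_sum: "?F m - ?S (N j) \<in> greedy_sums b (tail (N j) c)" if "M j \<le> m" for j m
  proof -
    let ?B = "top_set h m"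
    have sub: "{n. n < N j \<and> 0 < h n} \<subseteq> ?B" using M(1)[of j] that by blast
    have gB: "greedy_set h ?B" by (rule greedy_set_top_set[OF lim])
    have "finite ?B" using gB by (simp add: greedy_set_def)
    then have "?F m = sum w (?B \<inter> {..<N j}) + sum w (?B - {..<N j})" by (rule sum.Int_Diff)
    moreover have "sum w (?B \<inter> {..<N j}) = ?S (N j)"
      using sub by (intro sum.mono_neutral_left) (auto simp: h_def w_def)
    moreover have "sum w (?B - {..<N j}) = (\<Sum>n\<in>?B - {..<N j}. tail (N j) c n *\<^sub>R b n)"
      by (intro sum.cong) (auto simp: w_def tail_def)
    moreover have "greedy_set (\<lambda>n. \<bar>tail (N j) c n\<bar>) (?B - {..<N j})"
      using gB sub unfolding h_def by (rule greedy_set_Diff_initial)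
    ultimately show ?thesis unfolding greedy_sums_def by (intro image_eqI[of _ _ "?B - {..<N j}"]) simp_all
  qed
  have "\<exists>v. norm v \<le> (1/4) ^ j \<and> (\<forall>m\<in>{M j..<M (Suc j)}. \<bar>?F m - ?S (N j)\<bar> \<le> v)" for j
  proof -
    let ?T = "(\<lambda>m. ?F m - ?S (N j)) ` {M j..<M (Suc j)}"
    have "finite ?T \<and> ?T \<subseteq> greedy_sums b (tail (N j) c)" using tail_sum by auto
    then obtain v where "norm v \<le> (1/4) ^ j" "\<forall>t\<in>?T. \<bar>t\<bar> \<le> v"
      using N(1)[of j] unfolding fin_dominated_def by meson
    then show ?thesis by (intro exI[of _ v]) auto
  qed
  then obtain v where v: "\<And>j. norm (v j) \<le> (1/4) ^ j"
      "\<And>j m. m \<in> {M j..<M (Suc j)} \<Longrightarrow> \<bar>?F m - ?S (N j)\<bar> \<le> v j"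
    by metis
  \<comment> \<open>Two errors of norm at most \<open>(1/4) ^ j\<close> each: a greedy sum of the
    tail, and the remainder of the basis expansion. This is the 2 in
    \<open>converges_uniformly_blocks\<close>.\<close>
  define z where "z = (\<lambda>j. \<bar>v j\<bar> + \<bar>x - ?S (N j)\<bar>)"
  have "converges_uniformly ?F x"
  proof (rule converges_uniformly_blocks)
    show "strict_mono M" using M(2) by (simp add: strict_mono_Suc_iff)
    show "0 \<le> z j" for j by (simp add: z_def)
    show "norm (z j) \<le> 2 * (1/4) ^ j" for j
    proof -
      have "norm (z j) \<le> norm (v j) + norm (x - ?S (N j))"
        unfolding z_def using norm_triangle_ineq[of "\<bar>v j\<bar>" "\<bar>x - ?S (N j)\<bar>"] by (simp add: norm_abs_eq)
      also have "\<dots> \<le> (1/4) ^ j + (1/4) ^ j" by (intro add_mono v N)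
      finally show ?thesis by simp
    qed
    fix j m assume "M j \<le> m" "m < M (Suc j)"
    then have Fv: "\<bar>?F m - ?S (N j)\<bar> \<le> \<bar>v j\<bar>"
      using v(2)[of m j] abs_ge_self[of "v j"] by (meson atLeastLessThan_iff order_trans)
    have "\<bar>?F m - x\<bar> = \<bar>(?F m - ?S (N j)) - (x - ?S (N j))\<bar>" by simp
    also have "\<dots> \<le> \<bar>?F m - ?S (N j)\<bar> + \<bar>x - ?S (N j)\<bar>" by (rule abs_triangle_ineq4)
    also have "\<dots> \<le> z j" unfolding z_def using Fv by simp
    finally show "\<bar>?F m - x\<bar> \<le> z j" .
  qed
  moreover have "natural_greedy_sum b m x = ?F m" for m
    using natural_greedy_sum_top_set[of b x m] lim by (simp add: h_def c_def w_def)
  ultimately show "converges_uniformly (\<lambda>m. natural_greedy_sum b m x) x" by simp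
qed

subsection \<open>Level sets and their rearrangements\<close>

lemma sorted_enumeration_exists:
  assumes "finite D"
  obtains g where "bij_betw g {..<card D} D"
    "\<And>i j. i < j \<Longrightarrow> j < card D \<Longrightarrow> precedes h (g i) (g j)"
proof -
  let ?r = "\<lambda>n. card {m\<in>D. precedes h m n}"
  define g where "g = inv_into D ?r"
  have bij: "bij_betw ?r D {..<card D}" by (rule rank_bij_finite[OF assms])
  have g: "bij_betw g {..<card D} D" unfolding g_def by (rule bij_betw_inv_into[OF bij])
  have rg: "?r (g i) = i" if "i < card D" for i
    unfolding g_def using bij_betw_inv_into_right[OF bij, of i] that by simp
  have "precedes h (g i) (g j)" if "i < j" "j < card D" for i j
  proof (rule ccontr)
    assume "\<not> precedes h (g i) (g j)"
    moreover have "g i \<noteq> g j" using that rg[of i] rg[of j] by auto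
    ultimately have "precedes h (g j) (g i)" using precedes_total by blast
    moreover have "g j \<in> D" using g that by (auto simp: bij_betw_def)
    ultimately have "?r (g j) < ?r (g i)" using assms by (intro rank_less) auto
    then show False using that rg[of i] rg[of j] by simp
  qed
  with g show ?thesis by (rule that)
qed

lemma bij_piecewise:
  fixes L :: "'k \<Rightarrow> 'b set"
  assumes disj: "\<And>j k n. n \<in> L j \<Longrightarrow> n \<in> L k \<Longrightarrow> j = k"
    and p: "\<And>k. bij_betw (p k) (L k) (L k)"
  obtains \<pi> where "bij \<pi>" "\<And>k. \<pi> ` L k = L k" "\<And>k n. n \<in> L k \<Longrightarrow> \<pi> n = p k n"
proof -
  define \<pi> where "\<pi> = (\<lambda>n. if \<exists>k. n \<in> L k then p (THE k. n \<in> L k) n else n)"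
  have \<pi>: "\<pi> n = p k n" if "n \<in> L k" for n k
  proof -
    have "(THE k. n \<in> L k) = k" using that disj by (intro the_equality) blast+
    then show ?thesis using that by (auto simp: \<pi>_def)
  qed
  have im: "\<pi> ` L k = L k" for k
    using p[of k] \<pi> by (simp add: bij_betw_def)
  have out: "\<pi> n = n" if "\<nexists>k. n \<in> L k" for n using that by (simp add: \<pi>_def)
  have "inj \<pi>"
  proof (rule injI)
    fix i j assume eq: "\<pi> i = \<pi> j"
    have same: "i \<in> L k \<longleftrightarrow> j \<in> L k" for k
    proof -
      have *: "i \<in> L k" if "\<pi> i = \<pi> j" "j \<in> L k" for i j
      proof (cases "\<exists>k'. i \<in> L k'")
        case True
        then obtain k' where k': "i \<in> L k'" by blast
        have "\<pi> i \<in> \<pi> ` L k'" "\<pi> j \<in> \<pi> ` L k" by (intro imageI k' that)+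
        then have "k' = k" unfolding im that(1) by (rule disj)
        then show ?thesis using k' by simp
      next
        case False
        then have "i \<in> \<pi> ` L k" using out[OF False] that imageI[OF that(2), of \<pi>] by simp
        then show ?thesis unfolding im .
      qed
      show ?thesis using *[of i j] *[of j i] eq by auto
    qed
    show "i = j"
    proof (cases "\<exists>k. i \<in> L k")
      case True
      then obtain k where k: "i \<in> L k" "j \<in> L k" using same by blast
      then have "p k i = p k j" using eq \<pi> by simp
      then show ?thesis using k p[of k] by (auto simp: bij_betw_def dest: inj_onD)
    next
      case False
      then have "\<nexists>k. j \<in> L k" using same by blast
      from out[OF this] out[OF False] eq show ?thesis by argo
    qed
  qed
  moreover have "n \<in> range \<pi>" for n
  proof (cases "\<exists>k. n \<in> L k")
    case True
    then obtain k where "n \<in> L k" by blast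
    then have "n \<in> \<pi> ` L k" unfolding im .
    then show ?thesis by (rule imageE) simp
  next
    case False
    from out[OF this] rangeI[of \<pi> n] show ?thesis by argo
  qed
  ultimately have "bij \<pi>" unfolding bij_def by blast
  then show ?thesis using im \<pi> by (rule that[of \<pi>])
qed

text \<open>(iii) speaks of one permutation acting on all levels, so the sorted listings
  \<open>g k\<close> are glued together. Composing \<open>g k\<close> with the inverse of the
  increasing enumeration makes \<open>\<pi>\<close> send the \<open>i\<close>-th element of a level
  to its \<open>i\<close>-th largest.\<close>

lemma sorting_permutation_exists:
  fixes L :: "'k \<Rightarrow> nat set"
  assumes fin: "\<And>k. finite (L k)" and disj: "\<And>j k n. n \<in> L j \<Longrightarrow> n \<in> L k \<Longrightarrow> j = k"
  obtains \<pi> where "bij \<pi>" "\<And>k. \<pi> ` L k = L k"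
    "\<And>k i j. i < j \<Longrightarrow> j < card (L k)
      \<Longrightarrow> precedes h (\<pi> (enumerate (L k) i)) (\<pi> (enumerate (L k) j))"
proof -
  have "\<exists>g. bij_betw g {..<card (L k)} (L k)
      \<and> (\<forall>i j. i < j \<longrightarrow> j < card (L k) \<longrightarrow> precedes h (g i) (g j))" for k
    by (rule sorted_enumeration_exists[OF fin, where h = h]) blast
  then obtain g where g: "\<And>k. bij_betw (g k) {..<card (L k)} (L k)"
    and sorted: "\<And>k i j. i < j \<Longrightarrow> j < card (L k) \<Longrightarrow> precedes h (g k i) (g k j)"
    by metis
  define p where "p = (\<lambda>k. g k \<circ> inv_into {..<card (L k)} (enumerate (L k)))"
  have s: "bij_betw (enumerate (L k)) {..<card (L k)} (L k)" for k
    by (rule finite_bij_enumerate[OF fin])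
  have "bij_betw (p k) (L k) (L k)" for k
    unfolding p_def by (rule bij_betw_trans[OF bij_betw_inv_into[OF s] g])
  then obtain \<pi> where \<pi>: "bij \<pi>" "\<And>k. \<pi> ` L k = L k" "\<And>k n. n \<in> L k \<Longrightarrow> \<pi> n = p k n"
    using bij_piecewise[of L p] disj by blast
  have \<pi>g: "\<pi> (enumerate (L k) i) = g k i" if "i < card (L k)" for k i
  proof -
    have "\<pi> (enumerate (L k) i) = p k (enumerate (L k) i)"
      using that fin by (intro \<pi>(3) finite_enumerate_in_set)
    then show ?thesis
      using that s[of k] by (simp add: p_def bij_betw_def)
  qed
  have "precedes h (\<pi> (enumerate (L k) i)) (\<pi> (enumerate (L k) j))"
    if "i < j" "j < card (L k)" for k i j
    using sorted[OF that] \<pi>g[of i k] \<pi>g[of j k] that by simp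
  with \<pi>(1,2) show ?thesis by (rule that)
qed

text \<open>\<open>p\<close> is the first position at which the listing leaves \<open>B\<close>. A
  later member of \<open>B\<close> would have to precede \<open>g p\<close>, against the sorting.
  Thus the part of a greedy set in one level is a partial sum along the sorted level.\<close>

lemma greedy_set_initial_segment:
  fixes t :: nat
  assumes B: "greedy_set h B" and g: "g ` {..<t} = D"
    and sorted: "\<And>i j. i < j \<Longrightarrow> j < t \<Longrightarrow> precedes h (g i) (g j)"
  obtains p where "p \<le> t" "B \<inter> D = g ` {..<p}"
proof -
  define p where "p = (LEAST i. \<not> (i < t \<and> g i \<in> B))"
  have notp: "\<not> (p < t \<and> g p \<in> B)" unfolding p_def by (rule LeastI[of _ t]) simp
  have below: "i < t \<and> g i \<in> B" if "i < p" for i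
    using not_less_Least that unfolding p_def by blast
  have "i < p" if i: "i < t" "g i \<in> B" for i
  proof (rule ccontr)
    assume "\<not> i < p"
    then have "p < i" using notp i by (cases "i = p") auto
    then have pi: "precedes h (g p) (g i)" "g p \<notin> B" using sorted i notp by auto
    then have "precedes h (g i) (g p)" using B i by (simp add: greedy_set_def)
    then show False using pi(1) precedes_irrefl precedes_trans by blast
  qed
  then have "B \<inter> D = g ` {..<p}" using below g by auto
  moreover have "p \<le> t" using below[of t] by (meson less_irrefl not_le)
  ultimately show ?thesis by (intro that)
qed

lemma greedy_set_threshold:
  assumes "finite {n. s < h n}" "0 \<le> s"
  shows "greedy_set h {n. s < h n}"
  unfolding greedy_set_def
proof (intro conjI ballI allI impI)
  show "finite {n. s < h n}" by fact
  show "0 < h i" if "i \<in> {n. s < h n}" for i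
    using that assms(2) by simp
  show "precedes h i j" if "i \<in> {n. s < h n}" "j \<notin> {n. s < h n}" for i j
    using that by (auto simp: precedes_def)
qed

lemma powi_level_exists:
  fixes a s :: real
  assumes "1 < a" "0 < s"
  obtains k where "a powi k < s" "s \<le> a powi (k + 1)"
proof -
  \<comment> \<open>Levels are open on the left and closed on the right, hence ceiling minus 1 and
    not floor.\<close>
  define k where "k = \<lceil>log a s\<rceil> - 1"
  have powi: "a powi j = a powr j" for j using assms by (simp add: powr_real_of_int')
  have s: "a powr log a s = s" using assms by simp
  have "real_of_int k < log a s" unfolding k_def by linarith
  then have "a powr k < a powr log a s" using assms by (intro powr_less_mono) auto
  moreover have "log a s \<le> real_of_int (k + 1)" unfolding k_def by linarith
  then have "a powr log a s \<le> a powr (k + 1)" using assms by (intro powr_mono) auto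
  ultimately show ?thesis using powi s by (intro that[of k]) auto
qed

lemma level_set_disjoint:
  assumes "1 < a" "n \<in> level_set a e x j" "n \<in> level_set a e x k"
  shows "j = k"
proof -
  have "\<not> j < k" if n: "n \<in> level_set a e x j" "n \<in> level_set a e x k" for j k
  proof
    assume "j < k"
    then have "a powi (j + 1) \<le> a powi k" using assms(1) by (intro power_int_increasing) auto
    then show False using n by (simp add: level_set_def)
  qed
  then show ?thesis using assms(2,3) by (meson linorder_neqE)
qed

lemma finite_above:
  assumes "h \<longlonglongrightarrow> (0::real)" "0 < s"
  shows "finite {n::nat. s < h n}"
proof -
  have "\<forall>\<^sub>F n in sequentially. h n < s" using assms by (rule order_tendstoD)
  then obtain K where "\<And>n. K \<le> n \<Longrightarrow> h n < s" by (auto simp: eventually_sequentially)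
  then have "n < K" if "s < h n" for n using that by (meson less_asym not_le)
  then have "{n. s < h n} \<subseteq> {..<K}" by blast
  then show ?thesis by (rule finite_subset) simp
qed

lemma finite_level_set:
  assumes "(\<lambda>n. \<bar>coef e n x\<bar>) \<longlonglongrightarrow> 0" "1 < a"
  shows "finite (level_set a e x k)"
proof (rule finite_subset)
  show "level_set a e x k \<subseteq> {n. a powi k < \<bar>coef e n x\<bar>}" by (auto simp: level_set_def)
  show "finite {n. a powi k < \<bar>coef e n x\<bar>}"
    using assms by (intro finite_above) auto
qed

lemma level_sup_nonneg: "0 \<le> level_sup a e x \<pi> k"
  unfolding level_sup_def Let_def by (rule fin_sup_nonneg) auto

lemma partial_sum_le_level_sup:
  assumes "p \<le> card (level_set a e x k)"
  shows "\<bar>\<Sum>i<p. coef e (\<pi> (enumerate (level_set a e x k) i)) x *\<^sub>R e (\<pi> (enumerate (level_set a e x k) i))\<bar>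
    \<le> level_sup a e x \<pi> k"
\<comment> \<open>The supremum in \<open>level_sup\<close> starts at 1; the empty sum is covered by
  its nonnegativity.\<close>
proof (cases "p = 0")
  case False
  then show ?thesis unfolding level_sup_def Let_def using assms
    by (intro fin_sup_upper) auto
qed (simp add: level_sup_nonneg)

subsection \<open>Scaled bases\<close>

text \<open>Rescaling moves a coefficient by at most the factor \<open>a\<close>, that is, across at most one level.\<close>

lemma level_split:
  fixes c l :: "nat \<Rightarrow> real" and L :: "int \<Rightarrow> nat set"
  assumes a: "1 < a" and l: "\<And>n. 1 \<le> \<bar>l n\<bar> \<and> \<bar>l n\<bar> \<le> a"
    and B: "greedy_set (\<lambda>n. \<bar>c n / l n\<bar>) B" "B \<noteq> {}"
    and L: "\<And>k. L k = {n. a powi k < \<bar>c n\<bar> \<and> \<bar>c n\<bar> \<le> a powi (k + 1)}"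
  obtains k where "{n. a powi (k + 1) < \<bar>c n\<bar>} \<subseteq> B"
    "B \<subseteq> {n. a powi (k + 1) < \<bar>c n\<bar>} \<union> L k \<union> L (k - 1)"
proof -
  define h where "h = (\<lambda>n. \<bar>c n / l n\<bar>)"
  have hc: "h n \<le> \<bar>c n\<bar>" "\<bar>c n\<bar> \<le> h n * a" for n
  proof -
    have l0: "0 < \<bar>l n\<bar>" using l[of n] by linarith
    have "\<bar>c n\<bar> * 1 \<le> \<bar>c n\<bar> * \<bar>l n\<bar>" using l[of n] by (intro mult_left_mono) auto
    then show "h n \<le> \<bar>c n\<bar>" using l0 by (simp add: h_def divide_le_eq)
    have "\<bar>c n\<bar> = h n * \<bar>l n\<bar>" using l0 by (simp add: h_def)
    also have "\<dots> \<le> h n * a" using l[of n] by (intro mult_left_mono) (auto simp: h_def)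
    finally show "\<bar>c n\<bar> \<le> h n * a" .
  qed
  have fin: "finite B" using B(1) by (simp add: greedy_set_def)
  \<comment> \<open>The least scaled modulus on \<open>B\<close> is the cut-off. With
    \<open>t\<close> in level \<open>j\<close>, an index with \<open>\<bar>c n\<bar>\<close> above
    \<open>a powi (j + 2)\<close> has scaled modulus above \<open>t\<close>, so it is in
    \<open>B\<close>; members of \<open>B\<close> have \<open>\<bar>c n\<bar>\<close> above
    \<open>a powi j\<close>. Only levels \<open>j + 1\<close> and \<open>j\<close> are left, so
    \<open>k\<close> is \<open>j + 1\<close>.\<close>
  define t where "t = Min (h ` B)"
  have "t \<in> h ` B" unfolding t_def using fin B(2) by (intro Min_in) auto
  then obtain n0 where n0: "n0 \<in> B" "t = h n0" by blast
  have t_le: "t \<le> h n" if "n \<in> B" for n unfolding t_def using fin that by simp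
  have "0 < t" using n0 B(1) by (simp add: greedy_set_def h_def)
  with a obtain j where j: "a powi j < t" "t \<le> a powi (j + 1)" by (rule powi_level_exists)
  have step: "a powi (j + 1 + 1) = a powi (j + 1) * a"
    using a by (intro power_int_add_1) simp
  have "n \<in> B" if n: "a powi (j + 1 + 1) < \<bar>c n\<bar>" for n
  proof (rule ccontr)
    assume "n \<notin> B"
    then have "precedes h n0 n" using B(1) n0(1) by (simp add: greedy_set_def h_def)
    then have "h n \<le> t" using n0(2) by (auto simp: precedes_def)
    then have "h n * a \<le> a powi (j + 1) * a" using j(2) a by (intro mult_right_mono) auto
    then show False using n hc(2)[of n] step by linarith
  qed
  moreover have "a powi j < \<bar>c n\<bar>" if "n \<in> B" for n
    using t_le[OF that] hc(1)[of n] j(1) by linarith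
  ultimately show ?thesis by (intro that[of "j + 1"]) (auto simp: L)
qed

text \<open>The sorting permutation depends on \<open>x\<close> and \<open>l\<close> but not on the
  greedy set, so the single constant that \<open>bounded\<close> supplies for it serves all greedy
  sums at once.\<close>

lemma scaled_greedy_sums_dominated:
  fixes e :: "nat \<Rightarrow> 'a::banach_lattice"
  assumes E: "subspace E" and e: "schauder_basis E e" and x: "x \<in> E"
    and lim: "(\<lambda>n. \<bar>coef e n x\<bar>) \<longlonglongrightarrow> 0" and uqg: "uniformly_quasi_greedy E e"
    and a: "1 < a" and l: "\<And>n. 1 \<le> \<bar>l n\<bar> \<and> \<bar>l n\<bar> \<le> a"
    and bounded: "\<And>\<pi>. bij \<pi> \<Longrightarrow> (\<And>k. \<pi> ` level_set a e x k = level_set a e x k)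
      \<Longrightarrow> \<exists>C. \<forall>N :: nat. norm (fin_sup (level_sup a e x \<pi>) {- int N..int N}) \<le> C"
  shows "\<exists>C. fin_dominated C
    (greedy_sums (\<lambda>n. l n *\<^sub>R e n) (\<lambda>n. coef (\<lambda>n. l n *\<^sub>R e n) n x))"
proof -
  define c where "c = (\<lambda>n. coef e n x)"
  define w where "w = (\<lambda>n. c n *\<^sub>R e n)"
  define h where "h = (\<lambda>n. \<bar>c n / l n\<bar>)"
  define L where "L = level_set a e x"
  have L: "L k = {n. a powi k < \<bar>c n\<bar> \<and> \<bar>c n\<bar> \<le> a powi (k + 1)}" for k
    by (simp add: L_def level_set_def c_def)
  have l0: "l n \<noteq> 0" for n using l[of n] by auto
  have coef: "coef (\<lambda>n. l n *\<^sub>R e n) n x = c n / l n" for n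
    unfolding c_def by (rule coef_scaled[OF E e l0 x])
  have fin: "finite (L k)" for k unfolding L_def by (rule finite_level_set[OF lim a])
  have disj: "j = k" if "n \<in> L j" "n \<in> L k" for n j k
    using that unfolding L_def by (rule level_set_disjoint[OF a])
  obtain u where u: "\<And>B. greedy_set (\<lambda>n. \<bar>c n\<bar>) B \<Longrightarrow> \<bar>sum w B\<bar> \<le> u"
    using uniformly_quasi_greedy_order_bounded[OF uqg x lim] unfolding w_def c_def by blast
  have u0: "0 \<le> u" using u[of "{}"] by (simp add: greedy_set_def)
  obtain \<pi> where \<pi>: "bij \<pi>" "\<And>k. \<pi> ` L k = L k"
    and sorted: "\<And>k i j. i < j \<Longrightarrow> j < card (L k)
        \<Longrightarrow> precedes h (\<pi> (enumerate (L k) i)) (\<pi> (enumerate (L k) j))"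
    by (rule sorting_permutation_exists[of L, OF fin disj, where h = h]) blast+
  let ?V = "\<lambda>N :: nat. fin_sup (level_sup a e x \<pi>) {- int N..int N}"
  obtain C where C: "\<And>N. norm (?V N) \<le> C"
    using bounded[OF \<pi>(1)] \<pi>(2) unfolding L_def by blast
  have part: "\<bar>sum w (B \<inter> L k)\<bar> \<le> level_sup a e x \<pi> k" if B: "greedy_set h B" for B k
  proof -
    define g where "g = \<pi> \<circ> enumerate (L k)"
    have s: "bij_betw (enumerate (L k)) {..<card (L k)} (L k)" by (rule finite_bij_enumerate[OF fin])
    have "bij_betw \<pi> (L k) (L k)" 
      using inj_on_subset[OF bij_is_inj[OF \<pi>(1)] subset_UNIV] \<pi>(2) by (simp add: bij_betw_def)
    then have g: "bij_betw g {..<card (L k)} (L k)" unfolding g_def using s by (rule bij_betw_trans[rotated])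
    have im: "g ` {..<card (L k)} = L k" using g by (simp add: bij_betw_def)
    have "precedes h (g i) (g j)" if "i < j" "j < card (L k)" for i j
      using sorted[OF that] by (simp add: g_def)
    with B im obtain p where p: "p \<le> card (L k)" "B \<inter> L k = g ` {..<p}"
      by (rule greedy_set_initial_segment)
    have "inj_on g {..<p}"
      using g p(1) by (auto simp: bij_betw_def intro: inj_on_subset)
    then have "sum w (B \<inter> L k) = (\<Sum>i<p. w (g i))" unfolding p(2) by (simp add: sum.reindex)
    then show ?thesis
      using partial_sum_le_level_sup[of p a e x k \<pi>] p(1) by (simp add: w_def c_def g_def L_def)
  qed
  have key: "\<exists>k. \<bar>sum w B\<bar> \<le> u + level_sup a e x \<pi> k + level_sup a e x \<pi> (k - 1)"
    if B: "greedy_set h B" for B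
  proof (cases "B = {}")
    case True
    then show ?thesis using u0 by (auto intro!: exI[of _ 0] add_nonneg_nonneg level_sup_nonneg)
  next
    case False
    obtain k where k: "{n. a powi (k + 1) < \<bar>c n\<bar>} \<subseteq> B" (is "?T \<subseteq> B")
        "B \<subseteq> {n. a powi (k + 1) < \<bar>c n\<bar>} \<union> L k \<union> L (k - 1)"
      using level_split[OF a l B[unfolded h_def] False L] by blast
    have finB: "finite B" using B by (simp add: greedy_set_def)
    \<comment> \<open>\<open>?T\<close> is cut out by a threshold on the unscaled moduli, so it is
      greedy for the original basis whatever \<open>l\<close> is.\<close>
    then have "greedy_set (\<lambda>n. \<bar>c n\<bar>) ?T"
      using a finite_subset[OF k(1)] by (intro greedy_set_threshold) auto
    then have T: "\<bar>sum w ?T\<bar> \<le> u" by (rule u)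
    have "a powi k < a powi (k + 1)" using a by (intro power_int_strict_increasing) auto
    then have dis: "?T \<inter> L k = {}" "?T \<inter> L (k - 1) = {}" "L k \<inter> L (k - 1) = {}"
      by (auto simp: L)
    have "B = ?T \<union> ((B \<inter> L k) \<union> (B \<inter> L (k - 1)))" using k by blast
    then have "sum w B = sum w (?T \<union> ((B \<inter> L k) \<union> (B \<inter> L (k - 1))))" by simp
    also have "\<dots> = sum w ?T + sum w ((B \<inter> L k) \<union> (B \<inter> L (k - 1)))"
      using finB finite_subset[OF k(1)] dis by (intro sum.union_disjoint) blast+
    also have "sum w ((B \<inter> L k) \<union> (B \<inter> L (k - 1))) = sum w (B \<inter> L k) + sum w (B \<inter> L (k - 1))"
      using finB dis by (intro sum.union_disjoint) blast+
    finally have "\<bar>sum w B\<bar> \<le> \<bar>sum w ?T\<bar> + \<bar>sum w (B \<inter> L k) + sum w (B \<inter> L (k - 1))\<bar>"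
      by (simp only: abs_triangle_ineq)
    also have "\<dots> \<le> \<bar>sum w ?T\<bar> + (\<bar>sum w (B \<inter> L k)\<bar> + \<bar>sum w (B \<inter> L (k - 1))\<bar>)"
      by (intro add_left_mono abs_triangle_ineq)
    also have "\<dots> \<le> u + (level_sup a e x \<pi> k + level_sup a e x \<pi> (k - 1))"
      by (intro add_mono T part[OF B])
    finally show ?thesis by (auto simp: add.assoc)
  qed
  have "fin_dominated (norm u + 2 * C) (sum w ` {B. greedy_set h B})"
    unfolding fin_dominated_def
  proof (intro allI impI)
    fix T assume "finite T \<and> T \<subseteq> sum w ` {B. greedy_set h B}"
    then obtain F where F: "finite F" "F \<subseteq> {B. greedy_set h B}" "T = sum w ` F"
      using finite_subset_image[of T "sum w" "{B. greedy_set h B}"] by blast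
    have "\<forall>B\<in>F. \<exists>k. \<bar>sum w B\<bar> \<le> u + level_sup a e x \<pi> k + level_sup a e x \<pi> (k - 1)"
      using F(2) key by blast
    then obtain k where k: "\<And>B. B \<in> F \<Longrightarrow>
        \<bar>sum w B\<bar> \<le> u + level_sup a e x \<pi> (k B) + level_sup a e x \<pi> (k B - 1)"
      by metis
    \<comment> \<open>The sum serves as a crude maximum, and \<open>+ 1\<close> leaves room for the
      level \<open>k B - 1\<close>.\<close>
    define N where "N = (\<Sum>B\<in>F. nat \<bar>k B\<bar> + 1)"
    have kN: "\<bar>k B\<bar> + 1 \<le> int N" if "B \<in> F" for B
    proof -
      have "nat \<bar>k B\<bar> + 1 \<le> N" unfolding N_def using F(1) that by (intro member_le_sum) auto
      then show ?thesis by linarith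
    qed
    have "\<bar>sum w B\<bar> \<le> u + 2 *\<^sub>R ?V N" if B: "B \<in> F" for B
    proof -
      have "level_sup a e x \<pi> (k B) \<le> ?V N" "level_sup a e x \<pi> (k B - 1) \<le> ?V N"
        using kN[OF B] by (intro fin_sup_upper; force)+
      then have "u + level_sup a e x \<pi> (k B) + level_sup a e x \<pi> (k B - 1) \<le> u + ?V N + ?V N"
        by (intro add_mono) auto
      with k[OF B] have "\<bar>sum w B\<bar> \<le> u + ?V N + ?V N" by (rule order_trans)
      then show ?thesis by (simp add: scaleR_2 add.assoc)
    qed
    moreover have "norm (u + 2 *\<^sub>R ?V N) \<le> norm u + 2 * C"
      using norm_triangle_ineq[of u "2 *\<^sub>R ?V N"] C[of N] by simp
    ultimately show "\<exists>v. norm v \<le> norm u + 2 * C \<and> (\<forall>t\<in>T. \<bar>t\<bar> \<le> v)"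
      using F(3) by blast
  qed
  \<comment> \<open>The scalars cancel in \<open>(c n / l n) *\<^sub>R l n *\<^sub>R e n\<close>:
    scaling changes which sets are greedy, but not the vectors that are summed.\<close>
  moreover have "greedy_sums (\<lambda>n. l n *\<^sub>R e n) (\<lambda>n. coef (\<lambda>n. l n *\<^sub>R e n) n x)
      = sum w ` {B. greedy_set h B}"
    using l0 by (simp add: greedy_sums_def coef h_def w_def)
  ultimately show ?thesis by auto
qed

text \<open>All coefficients of level \<open>k\<close> can be scaled into \<open>(a\<^sup>k, m]\<close>, where \<open>m\<close> is the least
  modulus on that level, and inside this interval into any prescribed order.\<close>

lemma scaling_along_permutation:
  fixes e :: "nat \<Rightarrow> 'a::real_normed_vector"
  assumes a: "1 < a" and lim: "(\<lambda>n. \<bar>coef e n x\<bar>) \<longlonglongrightarrow> 0"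
    and \<pi>: "bij \<pi>" "\<And>k. \<pi> ` level_set a e x k = level_set a e x k"
  obtains l where "\<And>n. 1 \<le> l n \<and> l n \<le> a"
    "\<And>k p. p \<le> card (level_set a e x k) \<Longrightarrow> greedy_set (\<lambda>n. \<bar>coef e n x / l n\<bar>)
      ({n. a powi (k + 1) < \<bar>coef e n x\<bar>} \<union> (\<lambda>i. \<pi> (enumerate (level_set a e x k) i)) ` {..<p})"
proof -
  define c where "c = (\<lambda>n. coef e n x)"
  define L where "L = level_set a e x"
  have L: "L k = {n. a powi k < \<bar>c n\<bar> \<and> \<bar>c n\<bar> \<le> a powi (k + 1)}" for k
    by (simp add: L_def level_set_def c_def)
  have fin: "finite (L k)" for k unfolding L_def by (rule finite_level_set[OF lim a])
  have disj: "j = k" if "n \<in> L j" "n \<in> L k" for n j k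
    using that unfolding L_def by (rule level_set_disjoint[OF a])
  have "\<exists>k. n \<in> L k" if "c n \<noteq> 0" for n
    using powi_level_exists[OF a, of "\<bar>c n\<bar>"] that by (metis L mem_Collect_eq zero_less_abs_iff)
  then obtain K where K: "\<And>n. c n \<noteq> 0 \<Longrightarrow> n \<in> L (K n)" by metis
  have pow_pos: "0 < a powi k" for k using a by simp
  have L_c: "c n \<noteq> 0" if "n \<in> L k" for n k
    using that pow_pos[of k] by (auto simp: L)
  define g where "g = (\<lambda>k i. \<pi> (enumerate (L k) i))"
  have g: "bij_betw (g k) {..<card (L k)} (L k)" for k
  proof -
    have "bij_betw \<pi> (L k) (L k)"
      using inj_on_subset[OF bij_is_inj[OF \<pi>(1)] subset_UNIV] \<pi>(2) by (simp add: bij_betw_def L_def)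
    with finite_bij_enumerate[OF fin] have "bij_betw (\<pi> \<circ> enumerate (L k)) {..<card (L k)} (L k)"
      by (rule bij_betw_trans)
    then show ?thesis by (simp add: g_def comp_def)
  qed
  define pos where "pos = (\<lambda>k. inv_into {..<card (L k)} (g k))"
  have pos: "pos k (g k i) = i" if "i < card (L k)" for k i
    using that g[of k] by (simp add: pos_def bij_betw_def)
  define m where "m = (\<lambda>k. Min ((\<lambda>n. \<bar>c n\<bar>) ` L k))"
  have m_le: "m k \<le> \<bar>c n\<bar>" if "n \<in> L k" for n k
    unfolding m_def using fin that by simp
  have m_gt: "a powi k < m k" if "n \<in> L k" for n k
  proof -
    have "m k \<in> (\<lambda>n. \<bar>c n\<bar>) ` L k" unfolding m_def using fin that by (intro Min_in) auto
    then show ?thesis by (auto simp: L)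
  qed
  \<comment> \<open>The target modulus at position \<open>i\<close>: it starts at
    \<open>m k\<close>, decreases strictly, and stays above \<open>a powi k\<close>. The upper end
    makes \<open>l\<close> at least 1; the lower end makes it at most \<open>a\<close> and keeps the
    levels apart.\<close>
  define D where "D = (\<lambda>k i. a powi k + (m k - a powi k) / (real i + 1))"
  define d where "d = (\<lambda>n. if c n = 0 then 0 else D (K n) (pos (K n) n))"
  have d: "d n = D k (pos k n)" if "n \<in> L k" for n k
  proof -
    have "K n = k" using K[OF L_c[OF that]] that by (rule disj)
    then show ?thesis using L_c[OF that] by (simp add: d_def)
  qed
  have d_bounds: "a powi k < d n" "d n \<le> \<bar>c n\<bar>" "\<bar>c n\<bar> \<le> a powi (k + 1)" if n: "n \<in> L k" for n k
  proof -
    have mk: "0 < m k - a powi k" using m_gt[OF n] by simp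
    show "a powi k < d n" using mk by (simp add: d[OF n] D_def)
    have "(m k - a powi k) / (real (pos k n) + 1) \<le> (m k - a powi k) / 1"
      using mk by (intro divide_left_mono) auto
    then have "d n \<le> m k" by (simp add: d[OF n] D_def)
    then show "d n \<le> \<bar>c n\<bar>" using m_le[OF n] by linarith
    show "\<bar>c n\<bar> \<le> a powi (k + 1)" using n by (simp add: L)
  qed
  have d_pos: "0 < d n" if "n \<in> L k" for n k
    using d_bounds(1)[OF that] pow_pos[of k] by linarith
  have d_anti: "d (g k j) < d (g k i)" if "i < j" "j < card (L k)" for i j k
  proof -
    have gL: "g k i \<in> L k" "g k j \<in> L k" using g[of k] that by (auto simp: bij_betw_def)
    have "(m k - a powi k) / (real j + 1) < (m k - a powi k) / (real i + 1)"
      using m_gt[OF gL(1)] that by (intro divide_strict_left_mono) auto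
    then show ?thesis using that gL by (simp add: d[OF gL(1)] d[OF gL(2)] pos D_def)
  qed
  have d_level: "d n' < d n" if "n \<in> L j" "n' \<in> L i" "i < j" for n n' i j
  proof -
    have "a powi (i + 1) \<le> a powi j" using a that(3) by (intro power_int_increasing) auto
    then show ?thesis using d_bounds[OF that(1)] d_bounds[OF that(2)] by linarith
  qed
  define l where "l = (\<lambda>n. if c n = 0 then 1 else \<bar>c n\<bar> / d n)"
  have l: "1 \<le> l n \<and> l n \<le> a" for n
  proof (cases "c n = 0")
    case False
    then have n: "n \<in> L (K n)" by (rule K)
    have "a powi (K n + 1) = a powi K n * a" using a by (intro power_int_add_1) simp
    moreover have "a powi K n * a \<le> d n * a" using d_bounds(1)[OF n] a by (intro mult_right_mono) auto
    ultimately have "\<bar>c n\<bar> \<le> a * d n" using d_bounds(3)[OF n] by (simp add: mult.commute)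
    then show ?thesis using False d_bounds(2)[OF n] d_pos[OF n] by (simp add: l_def field_simps)
  qed (use a in \<open>simp add: l_def\<close>)
  have hd: "\<bar>c n / l n\<bar> = d n" for n
  proof (cases "c n = 0")
    case False
    then show ?thesis using d_pos[OF K[OF False]] by (simp add: l_def abs_mult)
  qed (simp add: d_def)
  have "greedy_set (\<lambda>n. \<bar>c n / l n\<bar>) ({n. a powi (k + 1) < \<bar>c n\<bar>} \<union> g k ` {..<p})"
    if p: "p \<le> card (L k)" for k p
    unfolding greedy_set_def hd
  proof (intro conjI ballI allI impI)
    let ?G = "{n. a powi (k + 1) < \<bar>c n\<bar>} \<union> g k ` {..<p}"
    show "finite ?G" using finite_above[OF lim pow_pos] by (simp add: c_def)
    fix n assume n: "n \<in> ?G"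
    have gL: "g k i \<in> L k" if "i < p" for i using g[of k] p that by (auto simp: bij_betw_def)
    have "c n \<noteq> 0" using n L_c gL pow_pos[of "k + 1"] by auto
    then obtain j where j: "n \<in> L j" using K by blast
    show dn: "0 < d n" by (rule d_pos[OF j])
    \<comment> \<open>Members of the set have level at least \<open>k\<close>, and on level
      \<open>k\<close> they are among the first \<open>p\<close>; nonmembers will have level at most
      \<open>k\<close>. Ties in level are decided by position.\<close>
    have kj: "k \<le> j \<and> (j = k \<longrightarrow> n \<in> g k ` {..<p})"
    proof (cases "n \<in> g k ` {..<p}")
      case True
      then have "n \<in> L k" using gL by blast
      then show ?thesis using True disj[OF j] by auto
    next
      case False
      then have n': "a powi (k + 1) < \<bar>c n\<bar>" using n by blast
      have "k < j"
      proof (rule ccontr)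
        assume "\<not> k < j"
        then have "a powi (j + 1) \<le> a powi (k + 1)" using a by (intro power_int_increasing) auto
        then show False using n' d_bounds(3)[OF j] by linarith
      qed
      then show ?thesis by simp
    qed
    fix n' assume n': "n' \<notin> ?G"
    show "precedes d n n'"
    proof (cases "c n' = 0")
      case True
      then have "d n' = 0" by (simp add: d_def)
      then show ?thesis using dn by (simp add: precedes_def)
    next
      case False
      then obtain i where i: "n' \<in> L i" using K by blast
      have "i \<le> k"
      proof (rule ccontr)
        assume "\<not> i \<le> k"
        then have "a powi (k + 1) \<le> a powi i" using a by (intro power_int_increasing) auto
        then show False using n' i by (auto simp: L)
      qed
      have "d n' < d n"
      proof (cases "i < j")
        case True
        then show ?thesis by (rule d_level[OF j i])
      next
        case False
        then have ijk: "i = k" "j = k" using \<open>i \<le> k\<close> kj by auto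
        then obtain s where s: "n = g k s" "s < p" using kj by blast
        have "g k ` {..<card (L k)} = L k" using g by (simp add: bij_betw_def)
        then obtain s' where s': "n' = g k s'" "s' < card (L k)" using i ijk by blast
        have "\<not> s' < p" using n' s'(1) by blast
        then show ?thesis using d_anti[of s s' k] s s' by simp
      qed
      then show ?thesis by (simp add: precedes_def)
    qed
  qed
  then have "greedy_set (\<lambda>n. \<bar>coef e n x / l n\<bar>)
      ({n. a powi (k + 1) < \<bar>coef e n x\<bar>} \<union> (\<lambda>i. \<pi> (enumerate (level_set a e x k) i)) ` {..<p})"
    if "p \<le> card (level_set a e x k)" for k p
    using that by (simp add: c_def g_def L_def)
  with l show ?thesis by (rule that)
qed

text \<open>One scaling realizes \<open>\<pi>\<close> on all levels simultaneously, so a single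
  order bound for its greedy sums works for every \<open>k\<close>.\<close>

lemma level_sups_order_bounded:
  fixes e :: "nat \<Rightarrow> 'a::banach_lattice"
  assumes E: "subspace E" and e: "schauder_basis E e" and x: "x \<in> E"
    and a: "1 < a" and lim: "(\<lambda>n. \<bar>coef e n x\<bar>) \<longlonglongrightarrow> 0"
    and \<pi>: "bij \<pi>" "\<And>k. \<pi> ` level_set a e x k = level_set a e x k"
    and uqg: "\<And>l. (\<And>n. 1 \<le> \<bar>l n\<bar> \<and> \<bar>l n\<bar> \<le> a) \<Longrightarrow> uniformly_quasi_greedy E (\<lambda>n. l n *\<^sub>R e n)"
  shows "\<exists>u. \<forall>k. level_sup a e x \<pi> k \<le> u"
proof -
  define w where "w = (\<lambda>n. coef e n x *\<^sub>R e n)"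
  define L where "L = level_set a e x"
  define g where "g = (\<lambda>k i. \<pi> (enumerate (L k) i))"
  define Top where "Top = (\<lambda>k. {n. a powi (k + 1) < \<bar>coef e n x\<bar>})"
  obtain l where l: "\<And>n. 1 \<le> l n \<and> l n \<le> a"
    and greedy: "\<And>k p. p \<le> card (L k) \<Longrightarrow> greedy_set (\<lambda>n. \<bar>coef e n x / l n\<bar>) (Top k \<union> g k ` {..<p})"
    unfolding g_def L_def Top_def by (rule scaling_along_permutation[OF a lim \<pi>]) blast
  have l': "1 \<le> \<bar>l n\<bar> \<and> \<bar>l n\<bar> \<le> a" for n using l[of n] by simp
  have l0: "l n \<noteq> 0" for n using l[of n] by auto
  have coef: "coef (\<lambda>n. l n *\<^sub>R e n) n x = coef e n x / l n" for n
    by (rule coef_scaled[OF E e l0 x])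
  have "(\<lambda>n. \<bar>coef (\<lambda>n. l n *\<^sub>R e n) n x\<bar>) \<longlonglongrightarrow> 0"
  proof (rule Lim_null_comparison[OF always_eventually lim], rule allI)
    fix n
    have "\<bar>coef e n x\<bar> / \<bar>l n\<bar> \<le> \<bar>coef e n x\<bar> / 1" using l[of n] by (intro divide_left_mono) auto
    then show "norm \<bar>coef (\<lambda>n. l n *\<^sub>R e n) n x\<bar> \<le> \<bar>coef e n x\<bar>" by (simp add: coef abs_divide)
  qed
  from uniformly_quasi_greedy_order_bounded[OF uqg[OF l'] x this] obtain u
    where u: "\<And>B. greedy_set (\<lambda>n. \<bar>coef e n x / l n\<bar>) B \<Longrightarrow> \<bar>sum w B\<bar> \<le> u"
    using l0 by (auto simp: coef w_def)
  have u0: "0 \<le> u" using u[of "{}"] by (simp add: greedy_set_def)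
  have fin: "finite (L k)" for k unfolding L_def by (rule finite_level_set[OF lim a])
  have part: "\<bar>\<Sum>i<p. w (g k i)\<bar> \<le> u + u" if p: "p \<le> card (L k)" for k p
  proof -
    have enum: "bij_betw (enumerate (L k)) {..<card (L k)} (L k)" by (rule finite_bij_enumerate[OF fin])
    have "inj_on (enumerate (L k)) {..<p}"
      using enum p by (auto simp: bij_betw_def intro: inj_on_subset)
    then have inj: "inj_on (g k) {..<p}"
      unfolding g_def using bij_is_inj[OF \<pi>(1)] by (simp add: inj_on_def inj_def)
    have "enumerate (L k) i \<in> L k" if "i < p" for i
      using that p fin by (intro finite_enumerate_in_set) auto
    then have "g k i \<in> L k" if "i < p" for i
      using that \<pi>(2)[of k] by (auto simp: g_def L_def)
    then have dis: "Top k \<inter> g k ` {..<p} = {}"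
      by (force simp: Top_def L_def level_set_def)
    \<comment> \<open>The case \<open>p = 0\<close> provides the smaller greedy set of the
      difference; two terms bounded by \<open>u\<close> give \<open>u + u\<close>.\<close>
    have G: "greedy_set (\<lambda>n. \<bar>coef e n x / l n\<bar>) (Top k)" using greedy[of 0 k] by simp
    have "sum w (Top k \<union> g k ` {..<p}) = sum w (Top k) + sum w (g k ` {..<p})"
      using G dis by (intro sum.union_disjoint) (auto simp: greedy_set_def)
    then have "(\<Sum>i<p. w (g k i)) = sum w (Top k \<union> g k ` {..<p}) - sum w (Top k)"
      using inj by (simp add: sum.reindex)
    then have "\<bar>\<Sum>i<p. w (g k i)\<bar> \<le> \<bar>sum w (Top k \<union> g k ` {..<p})\<bar> + \<bar>sum w (Top k)\<bar>"
      by (simp only: abs_triangle_ineq4)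
    also have "\<dots> \<le> u + u" using u[OF greedy[OF p]] u[OF G] by (rule add_mono)
    finally show ?thesis .
  qed
  have "level_sup a e x \<pi> k \<le> u + u" for k
    unfolding level_sup_def Let_def
  proof (rule fin_sup_least)
    fix p assume "p \<in> {1..card (level_set a e x k)}"
    then show "\<bar>\<Sum>i<p. coef e (\<pi> (enumerate (level_set a e x k) i)) x
        *\<^sub>R e (\<pi> (enumerate (level_set a e x k) i))\<bar> \<le> u + u"
      using part[of p k] by (simp add: w_def g_def L_def)
  qed (use u0 in auto)
  then show ?thesis by blast
qed

theorem proposition3p1:
  fixes E :: "'a::banach_lattice set" and e :: "nat \<Rightarrow> 'a" and a :: real
  assumes "subspace E" and "closed E"
    and "schauder_basis E e" and "semi_normalized e" and "uniformly_quasi_greedy E e"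
    and "1 < a"
  shows
    "((\<forall>l :: nat \<Rightarrow> real. (\<forall>n. 1 \<le> \<bar>l n\<bar> \<and> \<bar>l n\<bar> \<le> a) \<longrightarrow>
         uniformly_quasi_greedy E (\<lambda>n. l n *\<^sub>R e n))
      \<longleftrightarrow>
      (\<forall>x\<in>E. \<forall>\<pi> :: nat \<Rightarrow> nat. bij \<pi> \<and> (\<forall>k. \<pi> ` level_set a e x k = level_set a e x k) \<longrightarrow>
         (\<exists>u. \<forall>k. level_sup a e x \<pi> k \<le> u)))
     \<and>
     ((\<forall>x\<in>E. \<forall>\<pi> :: nat \<Rightarrow> nat. bij \<pi> \<and> (\<forall>k. \<pi> ` level_set a e x k = level_set a e x k) \<longrightarrow>
         (\<exists>u. \<forall>k. level_sup a e x \<pi> k \<le> u))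
      \<longleftrightarrow>
      (\<forall>x\<in>E. \<forall>\<pi> :: nat \<Rightarrow> nat. bij \<pi> \<and> (\<forall>k. \<pi> ` level_set a e x k = level_set a e x k) \<longrightarrow>
         (\<exists>C>0. \<forall>N :: nat. norm (fin_sup (level_sup a e x \<pi>) {- int N..int N}) \<le> C)))"
    (is "(?i \<longleftrightarrow> ?ii) \<and> (_ \<longleftrightarrow> ?iii)")
proof -
  define c0 where "c0 = (INF n. norm (e n))"
  have c0: "0 < c0" "c0 \<le> norm (e n)" for n
  proof -
    show "0 < c0" using assms(4) by (simp add: semi_normalized_def c0_def)
    show "c0 \<le> norm (e n)"
      unfolding c0_def by (rule cINF_lower) (auto intro!: bdd_belowI[of _ 0])
  qed
  have lim: "(\<lambda>n. \<bar>coef e n x\<bar>) \<longlonglongrightarrow> 0" if "x \<in> E" for x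
    by (rule coef_tendsto_0[OF assms(3) that c0])
  have "?ii" if ?i
  proof (intro ballI allI impI)
    fix x and \<pi> :: "nat \<Rightarrow> nat"
    assume x: "x \<in> E" and \<pi>: "bij \<pi> \<and> (\<forall>k. \<pi> ` level_set a e x k = level_set a e x k)"
    show "\<exists>u. \<forall>k. level_sup a e x \<pi> k \<le> u"
      using that \<pi> by (intro level_sups_order_bounded[OF assms(1,3) x assms(6) lim[OF x]]) blast+
  qed
  moreover have "?iii" if ii: ?ii
  proof (intro ballI allI impI)
    fix x and \<pi> :: "nat \<Rightarrow> nat"
    assume x: "x \<in> E" and \<pi>: "bij \<pi> \<and> (\<forall>k. \<pi> ` level_set a e x k = level_set a e x k)"
    obtain u where u: "\<And>k. level_sup a e x \<pi> k \<le> u"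
      using mp[OF spec[OF bspec[OF ii x], of \<pi>] \<pi>] by blast
    have u0: "0 \<le> u" by (rule order_trans[OF level_sup_nonneg u])
    \<comment> \<open>The \<open>+ 1\<close> makes the constant strictly positive, as (iii) demands,
      even if \<open>u\<close> is 0.\<close>
    have "norm (fin_sup (level_sup a e x \<pi>) {- int N..int N}) \<le> norm u + 1" for N
    proof -
      have "fin_sup (level_sup a e x \<pi>) {- int N..int N} \<le> u"
        using u u0 by (intro fin_sup_least) auto
      moreover have "0 \<le> fin_sup (level_sup a e x \<pi>) {- int N..int N}"
        by (intro fin_sup_nonneg level_sup_nonneg) auto
      ultimately have "norm (fin_sup (level_sup a e x \<pi>) {- int N..int N}) \<le> norm u"
        by (intro norm_mono_nonneg) (simp add: abs_of_nonneg)
      then show ?thesis by simp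
    qed
    moreover have "0 < norm u + 1" using norm_ge_zero[of u] by linarith
    ultimately show "\<exists>C>0. \<forall>N :: nat. norm (fin_sup (level_sup a e x \<pi>) {- int N..int N}) \<le> C"
      by blast
  qed
  moreover have "?i" if iii: ?iii
  proof (intro allI impI)
    fix l :: "nat \<Rightarrow> real" assume l: "\<forall>n. 1 \<le> \<bar>l n\<bar> \<and> \<bar>l n\<bar> \<le> a"
    then have l0: "l n \<noteq> 0" for n by (metis abs_zero not_one_le_zero)
    show "uniformly_quasi_greedy E (\<lambda>n. l n *\<^sub>R e n)"
    proof (rule uniformly_quasi_greedyI[OF assms(1,2) schauder_basis_scaled[OF assms(1,3) l0] c0(1)])
      \<comment> \<open>Since \<open>\<bar>l n\<bar>\<close> is at least 1, scaling preserves the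
        lower bound that sends the coefficients to 0.\<close>
      show "c0 \<le> norm (l n *\<^sub>R e n)" for n
        using mult_mono[of 1 "\<bar>l n\<bar>" c0 "norm (e n)"] l c0 by simp
      fix x assume x: "x \<in> E"
      show "\<exists>C. fin_dominated C (greedy_sums (\<lambda>n. l n *\<^sub>R e n) (\<lambda>n. coef (\<lambda>n. l n *\<^sub>R e n) n x))"
      proof (rule scaled_greedy_sums_dominated[OF assms(1,3) x lim[OF x] assms(5,6)])
        show "1 \<le> \<bar>l n\<bar> \<and> \<bar>l n\<bar> \<le> a" for n using l by blast
        show "\<exists>C. \<forall>N :: nat. norm (fin_sup (level_sup a e x \<pi>) {- int N..int N}) \<le> C"
          if "bij \<pi>" "\<And>k. \<pi> ` level_set a e x k = level_set a e x k" for \<pi>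
          using mp[OF spec[OF bspec[OF iii x], of \<pi>]] that by auto
      qed
    qed
  qed
  ultimately show ?thesis by blast
qed

end
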